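(* Let $0\le b\le a<\infty$ with $a>0$, and let $X_{\mathcal{P}}(x)=P_x$ and $X_{\mathcal{T}}(x)=T_x$ be the numbers of trapeziums deposited on $\mathcal{P}_x$ and $\mathcal{T}_x$ under the uniform depositing algorithm with parameters $a,b$. There exist finite constants $\lambda_2(a,b)>0$ and $C_{a,b}>0$ such that, for all $x>(3a-b)/2$, $$\max_{s\in\{\mathcal{P},\mathcal{T}\}}\left|\mathrm{Var}(X_s(x))-\lambda_2(a,b)\left(x+\frac{a+b}{2}\right)\right|\le C_{a,b}\,\mathcal{R}_2(x),$$ where $$\mathcal{R}_2(x)=\begin{cases}\left(\dfrac{4e}{x/a}\right)^{x/a-4}, & \text{if } a=b,\\[2ex]\left(\dfrac{4e}{x/a}\right)^{x/a-(5+(a+b)/(2a))}, & \text{if } a>b.\end{cases}$$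
   Context: Fix reals $0\le b\le a<\infty$ with $a>0$. "Trapezium" means isosceles trapezium (degenerating to a triangle if $b=0$ and a rectangle if $a=b$). Strips. $\mathcal{T}_x$ is the trapezium of height $1$ with lower base of length $x+(a-b)/2$ and upper base of length $x-(a-b)/2$. $\mathcal{P}_x$ is the parallelogram of height $1$ with two horizontal parallel sides of length $x$ and acute angle $\arctan(2/(a-b))$ (and $\pi/2$ if $a=b$), whose left-most point is on the upper line. Both have area $x$. The deposited particle is a copy of $\mathcal{T}_{(a+b)/2}$ (bases $a$ and $b$, height $1$), placed with its longer base on the upper line ("up") or on the lower line ("down") of the strip; its position is given by the distance from the left end of that line to the left endpoint of the longer base. Uniform depositing algorithm (UDA). On $\mathcal{P}_x$ with $x>a$: draw $\tau\sim\mathcal{U}(0,2x-2a)$. If $\tau\in(0,x-a)$, deposit up at position $\tau$; the remaining region consists of two strips $\mathcal{P}_\tau$ and $\mathcal{T}_{x-\tau-(a+b)/2}$. If $\tau\in[x-a,2x-2a)$, deposit down at position $y=\tau+a-x$; the remaining strips are $\mathcal{T}_{t}$ and $\mathcal{P}_{x-t-(a+b)/2}$ with $t=y+(a-b)/2$. On $\mathcal{T}_x$ with $(a+b)/2<x<(3a-b)/2$: draw $\tau\sim\mathcal{U}(0,x-(a+b)/2)$ and deposit down at position $\tau$; the remaining strips are $\mathcal{P}_\tau$ and $\mathcal{P}_{x-\tau-(a+b)/2}$. On $\mathcal{T}_x$ with $x\ge(3a-b)/2$ (and $x>(a+b)/2$): draw $\tau\sim\mathcal{U}(0,2x-2a)$.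 If $\tau\in(0,x-(3a-b)/2)$, deposit up at position $\tau$; the remaining strips are $\mathcal{T}_{\tau+(a-b)/2}$ and $\mathcal{T}_{x-\tau-a}$. If $\tau\in[x-(3a-b)/2,2x-2a)$, deposit down at position $y=\tau-(x-(3a-b)/2)$; the remaining strips are $\mathcal{P}_y$ and $\mathcal{P}_{x-y-(a+b)/2}$. (Strips are identified up to reflection.) Conditionally on the first deposition, the procedure continues on the two remaining strips with independent copies of the UDA, recursively, until no remaining strip can fit $\mathcal{T}_{(a+b)/2}$. $P_x$ (resp. $T_x$) is the total number of particles deposited on $\mathcal{P}_x$ (resp. $\mathcal{T}_x$). Conventions: $P_x=0$ for $x\in[0,a)$, $P_a=1$, $T_x=0$ for $x\in[0,(a+b)/2)$, $T_{(a+b)/2}=1$. The constants $\lambda_2(a,b)$ and $C_{a,b}$ depend only on $a,b$. *)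

theory Defs
  imports "HOL-Probability.Probability"
begin

text \<open>
  Strips of height 1, identified up to reflection and determined by their shape and area:
  \<open>Para x\<close> is the parallelogram with horizontal sides of length \<open>x\<close>, and \<open>Trap x\<close> is the isosceles
  trapezium with lower base \<open>x + (a - b) / 2\<close> and upper base \<open>x - (a - b) / 2\<close>.
\<close>

datatype strip = Para (area: real) | Trap (area: real)

text \<open>
  \<open>Up y\<close> and \<open>Down y\<close>: the longer base of the deposited particle lies on the upper,
  respectively lower, line of the strip, and its left endpoint is at distance \<open>y\<close> from the left end
  of that line.
\<close>

datatype placement = Up real | Down real

locale trapezium =
  fixes a b :: real
  assumes b_nonneg: "0 \<le> b" and b_le_a: "b \<le> a" and a_pos: "0 < a"
begin

text \<open>The area of the smallest strip of the given shape into which a particle fits.\<close>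

fun critical_area :: "strip \<Rightarrow> real" where
  "critical_area (Para x) = a"
| "critical_area (Trap x) = (a + b) / 2"

text \<open>
  The total length of the set of admissible placements. A trapezium of area less than
  \<open>(3 * a - b) / 2\<close> has an upper base shorter than \<open>a\<close>, so that only \<open>Down\<close> is possible.
\<close>

fun placement_length :: "strip \<Rightarrow> real" where
  "placement_length (Para x) = 2 * x - 2 * a"
| "placement_length (Trap x) = (if x < (3 * a - b) / 2 then x - (a + b) / 2 else 2 * x - 2 * a)"

fun place :: "strip \<Rightarrow> real \<Rightarrow> placement" where
  "place (Para x) \<tau> = (if \<tau> < x - a then Up \<tau> else Down (\<tau> + a - x))"
| "place (Trap x) \<tau> =
    (if x < (3 * a - b) / 2 then Down \<tau>
     else if \<tau> < x - (3 * a - b) / 2 then Up \<tau>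
     else Down (\<tau> - (x - (3 * a - b) / 2)))"

text \<open>The two strips to the left and to the right of the deposited particle.\<close>

fun remaining :: "strip \<Rightarrow> placement \<Rightarrow> strip \<times> strip" where
  "remaining (Para x) (Up y) = (Para y, Trap (x - y - (a + b) / 2))"
| "remaining (Para x) (Down y) =
    (let t = y + (a - b) / 2 in (Trap t, Para (x - t - (a + b) / 2)))"
| "remaining (Trap x) (Up y) = (Trap (y + (a - b) / 2), Trap (x - y - a))"
| "remaining (Trap x) (Down y) = (Para y, Para (x - y - (a + b) / 2))"

lemma remaining_area:
  assumes "0 < \<tau>" "\<tau> < placement_length s" "remaining s (place s \<tau>) = (l, r)"
  shows "area l \<le> area s - (a + b) / 2" "area r \<le> area s - (a + b) / 2"
  using assms b_nonneg b_le_a a_pos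
  by (cases s; auto simp: Let_def field_simps split: if_splits)+

lemma rank_decreasing:
  assumes "area s' \<le> area s - (a + b) / 2"
    and "\<not> area s < critical_area s" "area s \<noteq> critical_area s"
  shows "nat \<lceil>area s' / ((a + b) / 2)\<rceil> < nat \<lceil>area s / ((a + b) / 2)\<rceil>"
proof -
  have h: "0 < (a + b) / 2" using b_nonneg a_pos by simp
  have "0 < area s"
    using assms(2,3) h a_pos by (cases s) auto
  then have "0 < area s / ((a + b) / 2)" using h by (rule divide_pos_pos)
  moreover have "area s' / ((a + b) / 2) \<le> area s / ((a + b) / 2) - 1"
    using divide_right_mono[OF assms(1), of "(a + b) / 2"] h by (simp only: diff_divide_distrib) simp
  ultimately show ?thesis by linarith
qed

text \<open>
  The law of the number of particles deposited on a strip. Conditionally on \<open>\<tau>\<close>, the numbers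
  \<open>m\<close> and \<open>n\<close> deposited on the two remaining strips are independent. The test on \<open>\<tau>\<close>
  succeeds almost surely and is there for termination only.
\<close>

function num_particles :: "strip \<Rightarrow> nat measure" where
  "num_particles s =
    (if area s < critical_area s then return (count_space UNIV) 0
     else if area s = critical_area s then return (count_space UNIV) 1
     else do {
       \<tau> \<leftarrow> uniform_measure lborel {0<..<placement_length s};
       if 0 < \<tau> \<and> \<tau> < placement_length s then
         (case remaining s (place s \<tau>) of (l, r) \<Rightarrow> do {
           m \<leftarrow> num_particles l;
           n \<leftarrow> num_particles r;
           return (count_space UNIV) (1 + m + n)
         })
       else return (count_space UNIV) 0
     })"
  by auto
termination
proof (relation "Wellfounded.measure (\<lambda>s. nat \<lceil>area s / ((a + b) / 2)\<rceil>)", goal_cases)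
  case 1
  show ?case by simp
next
  case (2 s \<tau> l r)
  then show ?case
    unfolding in_measure
    by (intro rank_decreasing remaining_area(1)[where \<tau> = \<tau> and l = l and r = r]) auto
next
  case (3 s \<tau> l r m)
  then show ?case
    unfolding in_measure
    by (intro rank_decreasing remaining_area(2)[where \<tau> = \<tau> and l = l and r = r]) auto
qed

declare num_particles.simps [simp del]

end

definition R2 :: "real \<Rightarrow> real \<Rightarrow> real \<Rightarrow> real" where
  "R2 a b x =
    (if a = b then (4 * exp 1 / (x / a)) powr (x / a - 4)
     else (4 * exp 1 / (x / a)) powr (x / a - (5 + (a + b) / (2 * a))))"

end

theory Submission
  imports Defs
begin

text \<open>
  Write \<open>h = (a + b) / 2\<close> for the area of a particle and \<open>N\<close> for the number of particles deposited on
  a strip of area \<open>x\<close>. A deposition leaves two strips of total area \<open>x - h\<close>, so both \<open>x + h\<close> and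
  \<open>N + 1\<close> are additive: their value for a strip is the sum of their values for the two remaining
  strips. Hence the means \<open>p\<close> and \<open>t\<close> of \<open>N + 1\<close> on parallelograms and trapeziums satisfy, for large \<open>x\<close>,
  the system
    \<open>(x - a) p(x) = \<integral>[0, x - a] p + \<integral>[a - h, x - h] t\<close>,
    \<open>(x - a) t(x) = \<integral>[a - h, x - a] t + \<integral>[0, x - h] p\<close>,
  which the pair \<open>(x + h, x + h)\<close> solves up to additive constants. For every real \<open>c\<close>, the second moment
  \<open>W\<close> of \<open>N + 1 - c (x + h)\<close> satisfies the same system with additional forcing terms, which are
  convolutions of the errors \<open>p(x) - c (x + h)\<close> and \<open>t(x) - c (x + h)\<close> (\<open>Para_equation\<close>,
  \<open>Trap_equation\<close>, \<open>splits_mean\<close>, \<open>splits_square_deviation\<close>).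

  The analytic core is \<open>coupled_asymptotics\<close>: every locally bounded solution of the system with
  superexponentially small forcing terms equals \<open>c (x + h)\<close>, for some \<open>c\<close>, up to a superexponentially
  small error. The sum \<open>s = p + t\<close> and the difference \<open>p - t\<close> decouple. Up to forcing, the value of the
  difference at \<open>x\<close> is its integral over \<open>[x - a, x - h]\<close>, divided by \<open>-(x - a)\<close>, which implies rapid
  decay. For the sum, \<open>s(x) / (x + h)\<close> is close to a weighted average of its past values, and its
  oscillation over windows of length \<open>h\<close> contracts by factors tending to \<open>0\<close>; so it converges to some
  \<open>c\<close>, faster than any exponential. Passing to the limit in the equation then gives
    \<open>(x - a) E(x) = - \<integral>[x - a, \<infinity>) E - \<integral>[x - h, \<infinity>) E + forcing\<close>
  for \<open>E(x) = s(x) - c (x + h)\<close>. Thus \<open>E\<close> is bounded by its own tails, and as the mass of a tail sits near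
  its beginning, the decay improves to order \<open>(2 exp(\<eta>) a / x) ^ (x / a)\<close>, where \<open>\<eta>\<close> is determined by the
  forcing and can be any positive number if there is none (\<open>superexp_of_tail\<close>).

  Applied to the means, this yields \<open>c\<close> and the smallness of the errors; applied to \<open>W\<close> with this
  \<open>c\<close>, it yields a constant \<open>v\<close> such that \<open>W - v (x + h)\<close> is superexponentially small. The variance
  differs from \<open>W\<close> by the square of the error of the mean. The estimate obtained for the variance is of
  order \<open>(2 e a / x) ^ (x / a)\<close>, which is smaller than the rate claimed.

  Finally \<open>v > 0\<close>. Indeed \<open>c > 0\<close>, as the mean of \<open>N + 1\<close> is at least \<open>1\<close> while its error tends to
  \<open>0\<close>. At arbitrarily large \<open>x\<close> the number \<open>c (x + h)\<close> is half of an odd integer, hence at distance at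
  least \<open>1 / 2\<close> from the integer \<open>N + 1\<close>, so that \<open>W \<ge> 1 / 4\<close> there. This would be impossible if
  \<open>v \<le> 0\<close>.
\<close>

section \<open>Real-analytic preliminaries\<close>

text \<open>
  The supremum \<open>M\<close> of \<open>f\<close> on \<open>S\<close> is finite by the first assumption. As \<open>M\<close> is an upper bound, the second
  assumption gives \<open>M \<le> max N (M / 2 + R)\<close>, hence \<open>M \<le> max N (2 * R)\<close>.
\<close>

lemma le_max_of_halving:
  fixes f :: "'a \<Rightarrow> real"
  assumes bdd: "\<And>x. x \<in> S \<Longrightarrow> f x \<le> M0"
    and step: "\<And>M x. (\<And>z. z \<in> S \<Longrightarrow> f z \<le> M) \<Longrightarrow> x \<in> S \<Longrightarrow> f x \<le> max N (M / 2 + R)"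
    and x: "x \<in> S"
  shows "f x \<le> max N (2 * R)"
proof -
  define M where "M = (SUP x\<in>S. f x)"
  have bdd': "bdd_above (f ` S)"
    using bdd by (auto intro!: bdd_aboveI[of _ M0])
  have up: "f z \<le> M" if "z \<in> S" for z
    unfolding M_def using that by (rule cSUP_upper[OF _ bdd'])
  have "M \<le> max N (M / 2 + R)"
    unfolding M_def
    by (rule cSUP_least) (use x step up in \<open>auto simp: M_def[symmetric]\<close>)
  then have "M \<le> max N (2 * R)"
    by linarith
  with up[OF x] show ?thesis by simp
qed

lemma geometric_Cauchy_limit:
  fixes q :: "nat \<Rightarrow> real"
  assumes "0 < \<mu>" "\<mu> < 1" and step: "\<And>j. \<bar>q (Suc j) - q j\<bar> \<le> K * \<mu> ^ j"
  obtains \<alpha> where "\<And>j. \<bar>q j - \<alpha>\<bar> \<le> K / (1 - \<mu>) * \<mu> ^ j"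
proof -
  have sg: "(\<lambda>j. K * \<mu> ^ (j + i)) sums (K / (1 - \<mu>) * \<mu> ^ i)" for i
    using sums_mult[OF geometric_sums[of \<mu>], of "K * \<mu> ^ i"] assms
    by (simp add: power_add mult_ac divide_simps)
  have abs_sm: "summable (\<lambda>j. \<bar>q (Suc (j + i)) - q (j + i)\<bar>)" for i
    by (rule summable_comparison_test'[OF sums_summable[OF sg[of i]], of 0]) (use step in auto)
  have sm: "summable (\<lambda>j. q (Suc (j + i)) - q (j + i))" for i
    by (rule summable_rabs_cancel[OF abs_sm])
  define \<alpha> where "\<alpha> = q 0 + (\<Sum>j. q (Suc j) - q j)"
  have "(\<lambda>j. q (Suc j) - q j) sums (\<alpha> - q 0)"
    unfolding \<alpha>_def using sm[of 0] by (simp add: summable_sums)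
  then have "(\<lambda>n. q n - q 0) \<longlonglongrightarrow> \<alpha> - q 0"
    by (simp add: sums_def sum_lessThan_telescope)
  from tendsto_add[OF this tendsto_const[of "q 0"]] have lim: "q \<longlonglongrightarrow> \<alpha>"
    by simp
  have "\<bar>q i - \<alpha>\<bar> \<le> K / (1 - \<mu>) * \<mu> ^ i" for i
  proof -
    have "(\<lambda>n. q (n + i) - q i) \<longlonglongrightarrow> \<alpha> - q i"
      by (intro tendsto_intros LIMSEQ_ignore_initial_segment lim)
    moreover have "q (n + i) - q i = (\<Sum>j<n. q (Suc (j + i)) - q (j + i))" for n
      using sum_lessThan_telescope[of "\<lambda>j. q (j + i)" n] by simp
    ultimately have "(\<lambda>j. q (Suc (j + i)) - q (j + i)) sums (\<alpha> - q i)"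
      by (simp add: sums_def)
    then have "\<alpha> - q i = (\<Sum>j. q (Suc (j + i)) - q (j + i))"
      by (simp add: sums_iff)
    also have "\<bar>\<dots>\<bar> \<le> (\<Sum>j. \<bar>q (Suc (j + i)) - q (j + i)\<bar>)"
      by (rule summable_rabs[OF abs_sm])
    also have "\<dots> \<le> (\<Sum>j. K * \<mu> ^ (j + i))"
      by (rule suminf_le[OF step abs_sm sums_summable[OF sg]])
    also have "\<dots> = K / (1 - \<mu>) * \<mu> ^ i"
      using sg[of i] by (simp add: sums_iff)
    finally show ?thesis
      by (simp add: abs_minus_commute)
  qed
  then show ?thesis using that by blast
qed

lemma Max_pair_le: "f p \<le> B \<Longrightarrow> f q \<le> B \<Longrightarrow> (MAX s \<in> {p, q}. f s) \<le> (B :: real)"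
  by simp

lemma set_integrable_bounded:
  fixes g :: "real \<Rightarrow> real"
  assumes "g \<in> borel_measurable borel" "A \<in> sets borel" "emeasure lborel A < \<infinity>"
    and "\<And>x. x \<in> A \<Longrightarrow> \<bar>g x\<bar> \<le> K"
  shows "set_integrable lborel A g"
  unfolding set_integrable_def
proof (rule integrableI_bounded_set[where A = A and B = K])
  show "(\<lambda>x. indicat_real A x *\<^sub>R g x) \<in> borel_measurable lborel"
    using assms(1,2) by measurable
qed (use assms in \<open>auto simp: indicator_def\<close>)

lemma integral_shift_real: "integral {l..u} (\<lambda>\<tau>. g (\<tau> + c)) = integral {l + c..u + c} (g :: real \<Rightarrow> real)"
  using integral_shift_Icc_real[of l u g c] by (simp add: comp_def add.commute)

lemma integral_flip_real: "integral {l..u} (\<lambda>\<tau>. g (c - \<tau>)) = integral {c - u..c - l} (g :: real \<Rightarrow> real)"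
proof -
  have "integral {c - u..c - l} g = integral {- u..- l} (\<lambda>\<tau>. g (\<tau> + c))"
    using integral_shift_real[of "- u" "- l" g c] by (simp add: add.commute)
  also have "\<dots> = integral {l..u} (\<lambda>\<tau>. g (c - \<tau>))"
    using Henstock_Kurzweil_Integration.integral_reflect_real[of u l "\<lambda>\<tau>. g (c - \<tau>)"] by (simp add: add.commute)
  finally show ?thesis by simp
qed

lemma integrable_on_bounded:
  fixes g :: "real \<Rightarrow> real"
  assumes "g \<in> borel_measurable borel" "\<And>x. l \<le> x \<Longrightarrow> x \<le> u \<Longrightarrow> \<bar>g x\<bar> \<le> K"
  shows "g integrable_on {l..u}"
proof (rule set_borel_integral_eq_integral(1)[OF set_integrable_bounded])
  show "\<bar>g x\<bar> \<le> K" if "x \<in> {l..u}" for x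
    using assms(2) that by auto
qed (use assms in \<open>auto simp: emeasure_lborel_Icc_eq\<close>)

lemma integral_cong_except_right:
  fixes f g :: "real \<Rightarrow> real"
  assumes "\<And>x. l \<le> x \<Longrightarrow> x < u \<Longrightarrow> f x = g x"
  shows "integral {l..u} f = integral {l..u} g"
  by (rule integral_spike[of "{u}"]) (auto intro!: assms[symmetric] simp: less_le)

lemma abs_integral_le_const:
  fixes f :: "real \<Rightarrow> real"
  assumes "f integrable_on {l..u}" "l \<le> u" and "\<And>z. l \<le> z \<Longrightarrow> z \<le> u \<Longrightarrow> \<bar>f z\<bar> \<le> B"
  shows "\<bar>integral {l..u} f\<bar> \<le> B * (u - l)"
proof -
  have "norm (integral {l..u} f) \<le> integral {l..u} (\<lambda>_. B)"
    using assms by (intro integral_norm_bound_integral) auto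
  then show ?thesis
    using assms(2) by (simp add: mult.commute)
qed

section \<open>A system of two delay integral equations\<close>

text \<open>
  The two delays of the system are \<open>a\<close> and \<open>h\<close>. In the application \<open>h = (a + b) / 2\<close>, which satisfies
  the assumptions because \<open>0 \<le> b \<le> a\<close> and \<open>0 < a\<close>.
\<close>

locale delay =
  fixes a h :: real
  assumes h_pos: "0 < h" and h_le_a: "h \<le> a" and a_le_2h: "a \<le> 2 * h"
begin

lemma a_pos: "0 < a"
  using h_pos h_le_a by linarith

text \<open>
  The exponential weight \<open>2 ^ (- n x / a)\<close>. It is multiplied by \<open>2 ^ n\<close> when \<open>x\<close> decreases by \<open>a\<close>.
\<close>

definition rate :: "nat \<Rightarrow> real \<Rightarrow> real" where
  "rate n x = 2 powr (- (real n * x / a))"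

text \<open>
  Decay on \<open>[0, \<infinity>)\<close> faster than every exponential, without control of the constants.
\<close>

definition rapid :: "(real \<Rightarrow> real) \<Rightarrow> bool" where
  "rapid E \<longleftrightarrow> (\<forall>n. \<exists>C\<ge>0. \<forall>x\<ge>0. \<bar>E x\<bar> \<le> C * rate n x)"

text \<open>
  Quantitative superexponential decay. The choice \<open>2 ^ n \<approx> x / a\<close> turns the bound into one of order
  \<open>(2 exp(\<eta>) a / x) ^ (x / a)\<close>, see \<open>superexp_powr_bound\<close>. In this form, where the weight is exponential for
  each fixed \<open>n\<close>, integrals over tails and convolutions are easy to estimate.
\<close>

definition superexp :: "real \<Rightarrow> (real \<Rightarrow> real) \<Rightarrow> bool" where
  "superexp \<eta> E \<longleftrightarrow> (\<exists>C\<ge>0. \<forall>n. \<forall>x\<ge>0. \<bar>E x\<bar> \<le> C * exp (\<eta> * 2 ^ n) * rate n x)"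

lemma rate_pos [simp]: "0 < rate n x"
  by (simp add: rate_def)

lemma rate_nonneg [simp]: "0 \<le> rate n x"
  by (simp add: rate_def)

lemma rate_add: "rate n (x + y) = rate n x * rate n y"
  by (simp add: rate_def powr_add[symmetric] add_divide_distrib distrib_left)

lemma rate_zero_right [simp]: "rate n 0 = 1"
  by (simp add: rate_def)

lemma rate_zero_left [simp]: "rate 0 x = 1"
  by (simp add: rate_def)

lemma rate_Suc: "rate (Suc n) x = rate n x * rate 1 x"
  by (simp add: rate_def powr_add[symmetric] add_divide_distrib distrib_right add.commute)

lemma rate_antimono: "x \<le> y \<Longrightarrow> rate n y \<le> rate n x"
  using a_pos by (auto simp: rate_def divide_le_eq intro!: powr_mono mult_left_mono divide_right_mono)

lemma rate_le_1: "0 \<le> x \<Longrightarrow> rate n x \<le> 1"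
  using rate_antimono[of 0 x n] by simp

lemma rate_mono_index: "m \<le> n \<Longrightarrow> 0 \<le> x \<Longrightarrow> rate n x \<le> rate m x"
  using a_pos by (auto simp: rate_def intro!: powr_mono mult_right_mono divide_right_mono)

lemma rate_minus: "rate n (- x) = 1 / rate n x"
  using rate_add[of n x "- x"] by (simp add: eq_divide_eq mult.commute less_imp_neq[OF rate_pos, symmetric])

lemma rate_diff: "rate n (x - y) = rate n x / rate n y"
  using rate_add[of n x "- y"] by (simp add: rate_minus)

lemma rate_a: "rate n a = 1 / 2 ^ n"
proof -
  have "rate n a = 2 powr (- real n)"
    using a_pos by (simp add: rate_def)
  then show ?thesis
    by (simp add: powr_minus powr_realpow divide_inverse)
qed

lemma rate_shift: "rate n (x - a) = 2 ^ n * rate n x"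
  by (simp add: rate_diff rate_a)

lemma rate_mult_nat: "rate n (real j * x) = rate n x ^ j"
  by (induction j) (simp_all add: distrib_right rate_add)

lemma continuous_on_rate [continuous_intros]: "continuous_on S (rate n)"
  unfolding rate_def using a_pos by (intro continuous_intros) auto

lemma integrable_rate: "rate n integrable_on {l..u}"
  by (intro integrable_continuous_interval continuous_intros)

lemma integral_rate_le:
  assumes "0 < n" "l \<le> u"
  shows "integral {l..u} (rate n) \<le> a / (real n * ln 2) * rate n l"
proof -
  let ?c = "a / (real n * ln 2)"
  have rate_exp: "rate n = (\<lambda>x. exp (- (real n * ln 2 / a) * x))"
    by (auto simp: rate_def powr_def mult_ac)
  have "(rate n has_integral (- ?c * rate n u - (- ?c * rate n l))) {l..u}"
    unfolding rate_exp using assms a_pos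
    by (intro fundamental_theorem_of_calculus)
       (auto intro!: derivative_eq_intros simp: has_real_derivative_iff_has_vector_derivative[symmetric])
  then have "integral {l..u} (rate n) = ?c * rate n l - ?c * rate n u"
    by (simp add: integral_unique)
  moreover have "0 \<le> ?c * rate n u"
    using a_pos by simp
  ultimately show ?thesis by linarith
qed

lemma linear_rate_le:
  assumes "0 \<le> x"
  shows "(x + h) * rate 1 x \<le> 3 * a"
proof -
  have "1 + ln 2 * (x / a) \<le> exp (ln 2 * (x / a))"
    by (rule exp_ge_add_one_self)
  moreover have "exp (ln 2 * (x / a)) = 2 powr (x / a)"
    by (simp add: powr_def mult.commute)
  moreover have "1 / 2 * (x / a) \<le> ln 2 * (x / a)"
    using assms a_pos ln2_ge_two_thirds by (intro mult_right_mono) auto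
  ultimately have "x / a \<le> 2 * 2 powr (x / a)"
    by linarith
  then have "x * rate 1 x \<le> 2 * a"
    using a_pos by (simp add: rate_def powr_minus field_simps)
  moreover have "h * rate 1 x \<le> a"
    using mult_mono[OF h_le_a rate_le_1[OF assms, of 1]] a_pos by simp
  ultimately show ?thesis
    by (simp add: distrib_right)
qed

lemma superexp_imp_rapid: "superexp \<eta> E \<Longrightarrow> rapid E"
  unfolding superexp_def rapid_def
proof (intro allI)
  fix n
  assume "\<exists>C\<ge>0. \<forall>n. \<forall>x\<ge>0. \<bar>E x\<bar> \<le> C * exp (\<eta> * 2 ^ n) * rate n x"
  then obtain C where "C \<ge> 0" "\<And>n x. x \<ge> 0 \<Longrightarrow> \<bar>E x\<bar> \<le> C * exp (\<eta> * 2 ^ n) * rate n x"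
    by blast
  then show "\<exists>C\<ge>0. \<forall>x\<ge>0. \<bar>E x\<bar> \<le> C * rate n x"
    by (intro exI[of _ "C * exp (\<eta> * 2 ^ n)"]) auto
qed

lemma superexp_add:
  assumes "superexp \<eta> E" "superexp \<eta> F"
  shows "superexp \<eta> (\<lambda>x. E x + F x)"
proof -
  obtain C D where C: "C \<ge> 0" "\<And>n x. x \<ge> 0 \<Longrightarrow> \<bar>E x\<bar> \<le> C * exp (\<eta> * 2 ^ n) * rate n x"
    and D: "D \<ge> 0" "\<And>n x. x \<ge> 0 \<Longrightarrow> \<bar>F x\<bar> \<le> D * exp (\<eta> * 2 ^ n) * rate n x"
    using assms unfolding superexp_def by blast
  show ?thesis
    unfolding superexp_def
  proof (intro exI[of _ "C + D"] conjI allI impI)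
    fix n :: nat and x :: real assume "0 \<le> x"
    then show "\<bar>E x + F x\<bar> \<le> (C + D) * exp (\<eta> * 2 ^ n) * rate n x"
      using C(2)[of x n] D(2)[of x n] abs_triangle_ineq[of "E x" "F x"] by (simp add: distrib_right)
  qed (use C D in auto)
qed

lemma superexp_cmult:
  assumes "superexp \<eta> E"
  shows "superexp \<eta> (\<lambda>x. c * E x)"
proof -
  obtain C where C: "C \<ge> 0" "\<And>n x. x \<ge> 0 \<Longrightarrow> \<bar>E x\<bar> \<le> C * exp (\<eta> * 2 ^ n) * rate n x"
    using assms unfolding superexp_def by blast
  show ?thesis
    unfolding superexp_def
  proof (intro exI[of _ "\<bar>c\<bar> * C"] conjI allI impI)
    fix n :: nat and x :: real assume "0 \<le> x"
    then show "\<bar>c * E x\<bar> \<le> \<bar>c\<bar> * C * exp (\<eta> * 2 ^ n) * rate n x"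
      using mult_left_mono[OF C(2)[of x n], of "\<bar>c\<bar>"] by (simp add: abs_mult mult_ac)
  qed (use C in auto)
qed

lemma superexp_diff:
  "superexp \<eta> E \<Longrightarrow> superexp \<eta> F \<Longrightarrow> superexp \<eta> (\<lambda>x. E x - F x)"
  using superexp_add[OF _ superexp_cmult[of \<eta> F "-1"], of E] by simp

lemma superexp_mono:
  assumes "superexp \<eta> E" "\<eta> \<le> \<eta>'" "\<And>x. 0 \<le> x \<Longrightarrow> \<bar>F x\<bar> \<le> K * \<bar>E x\<bar>"
  shows "superexp \<eta>' F"
proof -
  obtain C where C: "C \<ge> 0" "\<And>n x. x \<ge> 0 \<Longrightarrow> \<bar>E x\<bar> \<le> C * exp (\<eta> * 2 ^ n) * rate n x"
    using assms unfolding superexp_def by blast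
  show ?thesis
    unfolding superexp_def
  proof (intro exI[of _ "\<bar>K\<bar> * C"] conjI allI impI)
    fix n :: nat and x :: real assume x: "0 \<le> x"
    have "\<bar>F x\<bar> \<le> \<bar>K\<bar> * \<bar>E x\<bar>"
      using assms(3)[OF x] mult_right_mono[of K "\<bar>K\<bar>" "\<bar>E x\<bar>"] by linarith
    also have "\<dots> \<le> \<bar>K\<bar> * (C * exp (\<eta> * 2 ^ n) * rate n x)"
      by (intro mult_left_mono C x) auto
    also have "\<dots> \<le> \<bar>K\<bar> * (C * exp (\<eta>' * 2 ^ n) * rate n x)"
      using assms(2) C by (intro mult_left_mono mult_right_mono) auto
    finally show "\<bar>F x\<bar> \<le> \<bar>K\<bar> * C * exp (\<eta>' * 2 ^ n) * rate n x"
      by (simp add: mult_ac)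
  qed (use C in auto)
qed

lemma rate_tendsto: "(rate 1 \<longlongrightarrow> 0) at_top"
proof (rule Lim_null_comparison)
  show "\<forall>\<^sub>F x in at_top. norm (rate 1 x) \<le> 3 * a / (h + x)"
    using eventually_ge_at_top[of 0]
  proof eventually_elim
    case (elim x)
    then show ?case
      using linear_rate_le[OF elim] h_pos by (simp add: field_simps)
  qed
  show "((\<lambda>x. 3 * a / (h + x)) \<longlongrightarrow> 0) at_top"
    by (intro tendsto_divide_0[OF tendsto_const] filterlim_at_top_imp_at_infinity
        filterlim_tendsto_add_at_top[OF tendsto_const] filterlim_ident)
qed

lemma rapid_tendsto:
  assumes "rapid E"
  shows "((\<lambda>x. (x + h) * E x) \<longlongrightarrow> 0) at_top"
proof -
  obtain C where C: "C \<ge> 0" "\<And>x. x \<ge> 0 \<Longrightarrow> \<bar>E x\<bar> \<le> C * rate 2 x"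
    using assms unfolding rapid_def by blast
  show ?thesis
  proof (rule Lim_null_comparison)
    show "\<forall>\<^sub>F x in at_top. norm ((x + h) * E x) \<le> C * (3 * a) * rate 1 x"
      using eventually_ge_at_top[of 0]
    proof eventually_elim
      case (elim x)
      have "norm ((x + h) * E x) = (x + h) * \<bar>E x\<bar>"
        using elim h_pos by (simp add: abs_mult)
      also have "\<dots> \<le> (x + h) * (C * rate 2 x)"
        using elim h_pos C by (intro mult_left_mono) auto
      also have "\<dots> = C * ((x + h) * rate 1 x) * rate 1 x"
        using rate_Suc[of 1 x] by (simp add: numeral_2_eq_2)
      also have "\<dots> \<le> C * (3 * a) * rate 1 x"
        using linear_rate_le[OF elim] C by (intro mult_right_mono mult_left_mono) auto
      finally show ?case .
    qed
    show "((\<lambda>x. C * (3 * a) * rate 1 x) \<longlongrightarrow> 0) at_top"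
      by (rule tendsto_mult_right_zero[OF rate_tendsto])
  qed
qed

text \<open>
  A rapidly decaying function that is bounded by its own tails decays superexponentially. Let \<open>M n\<close> be
  the best constant in \<open>\<bar>E x\<bar> \<le> M n * rate n x\<close>. For \<open>x \<ge> Y n\<close>, where \<open>Y n\<close> is of order \<open>2 ^ n / n\<close>, the
  hypothesis halves \<open>M n\<close>, up to the forcing term \<open>r\<close>. For \<open>x \<le> Y n\<close> one compares \<open>rate n\<close> with
  \<open>rate (n - 1)\<close>. This gives
    \<open>M n \<le> max (M (n - 1) * 2 powr (Y n / a)) (2 * C * exp (\<eta> * 2 ^ n))\<close>,
  and since \<open>Y n\<close> is small compared with \<open>2 ^ n\<close>, the bound \<open>M n \<le> D * exp (\<eta> * 2 ^ n)\<close> propagates.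
\<close>

lemma superexp_of_tail:
  assumes E: "rapid E" and r: "superexp \<eta> r" and \<eta>: "0 < \<eta>" and X: "0 \<le> X"
    and tail: "\<And>n M x. 0 < n \<Longrightarrow> X \<le> x \<Longrightarrow> (\<And>z. x - a \<le> z \<Longrightarrow> \<bar>E z\<bar> \<le> M * rate n z) \<Longrightarrow>
      (x - a) * \<bar>E x\<bar> \<le> 2 * (a / (real n * ln 2)) * 2 ^ n * M * rate n x + \<bar>r x\<bar>"
  shows "superexp \<eta> E"
proof -
  obtain C where C: "C \<ge> 0" "\<And>n x. x \<ge> 0 \<Longrightarrow> \<bar>r x\<bar> \<le> C * exp (\<eta> * 2 ^ n) * rate n x"
    using r unfolding superexp_def by blast
  define K where "K = X + a + 1"
  \<comment> \<open>beyond \<open>Y n\<close> the coefficient of \<open>M\<close> in the hypothesis is at most \<open>(x - a) / 2\<close>\<close>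
  define Y where "Y = (\<lambda>n :: nat. K + 4 * a * 2 ^ n / (real n * ln 2))"
  have contract: "\<bar>E x\<bar> / rate n x \<le> M / 2 + C * exp (\<eta> * 2 ^ n)"
    if n: "0 < n" and x: "Y n \<le> x" and M: "\<And>z. 0 \<le> z \<Longrightarrow> \<bar>E z\<bar> / rate n z \<le> M" for n M x
  proof -
    have Y0: "0 \<le> 4 * a * 2 ^ n / (real n * ln 2)" using a_pos by simp
    have xa: "1 \<le> x - a" "X \<le> x" "0 \<le> x - a" "0 \<le> x"
      using x Y0 a_pos X unfolding Y_def K_def by linarith+
    have "\<bar>E 0\<bar> \<le> M" using M[of 0] by simp
    then have M0: "0 \<le> M" by linarith
    have "4 * a * 2 ^ n / (real n * ln 2) \<le> x - a"
      using x X by (simp add: Y_def K_def)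
    then have main: "2 * (a / (real n * ln 2)) * 2 ^ n \<le> (x - a) / 2"
      by simp
    have t: "(x - a) * \<bar>E x\<bar> \<le> 2 * (a / (real n * ln 2)) * 2 ^ n * M * rate n x + \<bar>r x\<bar>"
    proof (rule tail[OF n \<open>X \<le> x\<close>])
      show "\<bar>E z\<bar> \<le> M * rate n z" if "x - a \<le> z" for z
        using M[of z] that xa by (simp add: pos_divide_le_eq)
    qed
    have "2 * (a / (real n * ln 2)) * 2 ^ n * M * rate n x \<le> (x - a) / 2 * M * rate n x"
      using main M0 by (intro mult_right_mono) auto
    moreover have "\<bar>r x\<bar> \<le> (x - a) * (C * exp (\<eta> * 2 ^ n) * rate n x)"
      using C(2)[OF \<open>0 \<le> x\<close>, of n] mult_right_mono[of 1 "x - a" "C * exp (\<eta> * 2 ^ n) * rate n x"] xa C(1)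
      by simp
    moreover have "(x - a) / 2 * M * rate n x + (x - a) * (C * exp (\<eta> * 2 ^ n) * rate n x)
       = (x - a) * ((M / 2 + C * exp (\<eta> * 2 ^ n)) * rate n x)"
      by (simp add: algebra_simps)
    ultimately have "(x - a) * \<bar>E x\<bar> \<le> (x - a) * ((M / 2 + C * exp (\<eta> * 2 ^ n)) * rate n x)"
      using t by linarith
    then have "\<bar>E x\<bar> \<le> (M / 2 + C * exp (\<eta> * 2 ^ n)) * rate n x"
      by (rule mult_left_le_imp_le) (use xa in auto)
    then show ?thesis
      by (simp add: pos_divide_le_eq)
  qed
  have improve: "\<bar>E x\<bar> / rate (Suc n) x \<le> max (B * 2 powr (Y (Suc n) / a)) (2 * (C * exp (\<eta> * 2 ^ Suc n)))"
    if B: "\<And>z. 0 \<le> z \<Longrightarrow> \<bar>E z\<bar> / rate n z \<le> B" and x: "0 \<le> x" for n B x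
  proof -
    obtain M0 where M0: "\<And>x. x \<ge> 0 \<Longrightarrow> \<bar>E x\<bar> \<le> M0 * rate (Suc n) x"
      using E unfolding rapid_def by blast
    show ?thesis
    proof (rule le_max_of_halving[where S = "{0..}" and f = "\<lambda>x. \<bar>E x\<bar> / rate (Suc n) x"])
      show "\<bar>E x\<bar> / rate (Suc n) x \<le> M0" if "x \<in> {0..}" for x
        using that M0 by (simp add: pos_divide_le_eq)
      show "\<bar>E x\<bar> / rate (Suc n) x \<le> max (B * 2 powr (Y (Suc n) / a)) (M / 2 + C * exp (\<eta> * 2 ^ Suc n))"
        if M: "\<And>z. z \<in> {0..} \<Longrightarrow> \<bar>E z\<bar> / rate (Suc n) z \<le> M" and x: "x \<in> {0..}" for M x
      proof (cases "Y (Suc n) \<le> x")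
        case True
        have "\<bar>E x\<bar> / rate (Suc n) x \<le> M / 2 + C * exp (\<eta> * 2 ^ Suc n)"
          by (rule contract[OF _ True]) (use M in auto)
        then show ?thesis by simp
      next
        case False
        have "\<bar>E 0\<bar> \<le> B" using B[of 0] by simp
        then have B0: "0 \<le> B" by linarith
        have "\<bar>E x\<bar> / rate (Suc n) x = \<bar>E x\<bar> / rate n x * 2 powr (x / a)"
          unfolding rate_Suc by (simp add: rate_def powr_minus divide_inverse)
        also have "\<dots> \<le> B * 2 powr (Y (Suc n) / a)"
          using B[of x] x B0 False a_pos by (intro mult_mono powr_mono divide_right_mono) auto
        finally show ?thesis by simp
      qed
    qed (use x in auto)
  qed
  have "\<forall>\<^sub>F n :: nat in sequentially. 2 powr (Y (Suc n) / a) \<le> exp (\<eta> * 2 ^ n)"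
  proof -
    have "filterlim (\<lambda>n. real n) at_top sequentially"
      by (rule filterlim_real_sequentially)
    then have e1: "\<forall>\<^sub>F n in sequentially. real n \<ge> 16 / \<eta>"
      by (simp add: filterlim_at_top)
    have e2: "\<forall>\<^sub>F n in sequentially. (2 :: real) ^ n \<ge> 2 * (K * ln 2 / a) / \<eta>"
    proof -
      obtain N where "2 * (K * ln 2 / a) / \<eta> < (2 :: real) ^ N"
        using real_arch_pow[of 2] by auto
      moreover have "(2 :: real) ^ N \<le> 2 ^ n" if "N \<le> n" for n
        using that by (simp add: power_increasing)
      ultimately show ?thesis
        unfolding eventually_sequentially by (meson less_imp_le order_trans)
    qed
    show ?thesis
      using e1 e2
    proof eventually_elim
      case (elim n)
      have "4 * 2 ^ Suc n / real (Suc n) \<le> \<eta> * 2 ^ n / 2"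
      proof -
        have "16 \<le> \<eta> * real (Suc n)"
          using elim(1) \<eta> by (simp add: field_simps)
        then have "16 * 2 ^ n \<le> \<eta> * real (Suc n) * 2 ^ n"
          by (intro mult_right_mono) auto
        then show ?thesis by (simp add: field_simps del: of_nat_Suc)
      qed
      moreover have "K * ln 2 / a \<le> \<eta> * 2 ^ n / 2"
        using elim(2) unfolding pos_divide_le_eq[OF \<eta>] by (simp add: mult.commute)
      moreover have "Y (Suc n) / a * ln 2 = K * ln 2 / a + 4 * 2 ^ Suc n / real (Suc n)"
        using a_pos unfolding Y_def by (simp add: field_simps del: of_nat_Suc power_Suc)
      ultimately have "Y (Suc n) / a * ln 2 \<le> \<eta> * 2 ^ n"
        by linarith
      then show ?case
        by (simp add: powr_def)
    qed
  qed
  then obtain n0 where n0: "\<And>n. n \<ge> n0 \<Longrightarrow> 2 powr (Y (Suc n) / a) \<le> exp (\<eta> * 2 ^ n)"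
    unfolding eventually_sequentially by blast
  obtain C0 where C0: "C0 \<ge> 0" "\<And>x. x \<ge> 0 \<Longrightarrow> \<bar>E x\<bar> \<le> C0 * rate n0 x"
    using E unfolding rapid_def by blast
  define D where "D = max (2 * C) C0"
  have D0: "0 \<le> D" using C0 by (simp add: D_def)
  have ex1: "1 \<le> exp (\<eta> * 2 ^ n)" for n :: nat
    using \<eta> by simp
  have large: "\<bar>E x\<bar> / rate n x \<le> D * exp (\<eta> * 2 ^ n)" if "n0 \<le> n" "0 \<le> x" for n x
    using that
  proof (induction n arbitrary: x rule: dec_induct)
    case base
    have "C0 * 1 \<le> D * exp (\<eta> * 2 ^ n0)"
      by (intro mult_mono ex1) (use C0 in \<open>auto simp: D_def\<close>)
    then have "C0 * rate n0 x \<le> D * exp (\<eta> * 2 ^ n0) * rate n0 x"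
      by (intro mult_right_mono) auto
    then have "\<bar>E x\<bar> \<le> D * exp (\<eta> * 2 ^ n0) * rate n0 x"
      using C0(2)[OF base] by linarith
    then show ?case
      by (simp add: pos_divide_le_eq)
  next
    case (step n)
    have "\<bar>E x\<bar> / rate (Suc n) x
        \<le> max (D * exp (\<eta> * 2 ^ n) * 2 powr (Y (Suc n) / a)) (2 * (C * exp (\<eta> * 2 ^ Suc n)))"
      by (rule improve) (use step in auto)
    also have "\<dots> \<le> D * exp (\<eta> * 2 ^ Suc n)"
    proof (rule max.boundedI)
      have "D * exp (\<eta> * 2 ^ n) * 2 powr (Y (Suc n) / a) \<le> D * exp (\<eta> * 2 ^ n) * exp (\<eta> * 2 ^ n)"
        using n0[of n] step D0 by (intro mult_left_mono) auto
      also have "\<dots> = D * exp (\<eta> * 2 ^ Suc n)"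
        by (simp add: exp_add[symmetric] mult.assoc)
      finally show "D * exp (\<eta> * 2 ^ n) * 2 powr (Y (Suc n) / a) \<le> D * exp (\<eta> * 2 ^ Suc n)" .
      show "2 * (C * exp (\<eta> * 2 ^ Suc n)) \<le> D * exp (\<eta> * 2 ^ Suc n)"
        by (simp add: D_def)
    qed
    finally show ?case .
  qed
  show ?thesis
    unfolding superexp_def
  proof (intro exI[of _ "D * exp (\<eta> * 2 ^ n0)"] conjI allI impI)
    show "0 \<le> D * exp (\<eta> * 2 ^ n0)" using D0 by simp
    fix n :: nat and x :: real assume x: "0 \<le> x"
    show "\<bar>E x\<bar> \<le> D * exp (\<eta> * 2 ^ n0) * exp (\<eta> * 2 ^ n) * rate n x"
    proof (cases "n0 \<le> n")
      case True
      have "\<bar>E x\<bar> \<le> D * exp (\<eta> * 2 ^ n) * rate n x"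
        using large[OF True x] by (simp add: pos_divide_le_eq)
      also have "\<dots> \<le> exp (\<eta> * 2 ^ n0) * (D * exp (\<eta> * 2 ^ n) * rate n x)"
        using mult_right_mono[OF ex1, of "D * exp (\<eta> * 2 ^ n) * rate n x"] D0 by simp
      finally show ?thesis by (simp add: mult_ac)
    next
      case False
      have "\<bar>E x\<bar> \<le> D * exp (\<eta> * 2 ^ n0) * rate n0 x"
        using large[OF order_refl x] by (simp add: pos_divide_le_eq)
      also have "\<dots> \<le> D * exp (\<eta> * 2 ^ n0) * rate n x"
        using False x D0 by (intro mult_left_mono rate_mono_index) auto
      also have "\<dots> \<le> exp (\<eta> * 2 ^ n) * (D * exp (\<eta> * 2 ^ n0) * rate n x)"
        using mult_right_mono[OF ex1, of "D * exp (\<eta> * 2 ^ n0) * rate n x"] D0 by simp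
      finally show ?thesis by (simp add: mult_ac)
    qed
  qed
qed

text \<open>
  A function that is controlled, with the factor \<open>1 / (x - a)\<close>, by its values on \<open>[x - a, x - h]\<close> decays
  rapidly: the bound propagates in steps of length \<open>h\<close> once \<open>x\<close> is large in terms of \<open>n\<close>.
\<close>

lemma rapid_of_delay:
  assumes bdd: "\<And>X. \<exists>K. \<forall>x. 0 \<le> x \<and> x \<le> X \<longrightarrow> \<bar>f x\<bar> \<le> K"
    and r: "rapid r" and X0: "0 \<le> X0"
    and delay: "\<And>n M x. X0 \<le> x \<Longrightarrow> (\<And>z. x - a \<le> z \<Longrightarrow> z \<le> x - h \<Longrightarrow> \<bar>f z\<bar> \<le> M * rate n z) \<Longrightarrow>
      (x - a) * \<bar>f x\<bar> \<le> a * 2 ^ n * M * rate n x + \<bar>r x\<bar>"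
  shows "rapid f"
  unfolding rapid_def
proof
  fix n
  obtain R where R: "R \<ge> 0" "\<And>x. x \<ge> 0 \<Longrightarrow> \<bar>r x\<bar> \<le> R * rate n x"
    using r unfolding rapid_def by blast
  define X where "X = X0 + 2 * a + 1 + 2 * a * 2 ^ n"
  obtain K where K: "\<And>x. 0 \<le> x \<Longrightarrow> x \<le> X \<Longrightarrow> \<bar>f x\<bar> \<le> K"
    using bdd by blast
  have "0 < a * 2 ^ n" using a_pos by simp
  have "0 \<le> X" using X0 a_pos by (simp add: X_def add_nonneg_nonneg)
  define M where "M = max (2 * R) (K / rate n X)"
  have M0: "0 \<le> M" using R by (simp add: M_def)
  have "\<bar>f x\<bar> \<le> M * rate n x" if "0 \<le> x" "x \<le> X + real j * h" for j x
    using that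
  proof (induction j arbitrary: x)
    case 0
    then have "\<bar>f x\<bar> \<le> K / rate n X * rate n X"
      using K[of x] by (simp add: less_imp_neq[OF rate_pos, symmetric])
    also have "\<dots> \<le> M * rate n x"
      using 0 M0 by (intro mult_mono rate_antimono) (auto simp: M_def)
    finally show ?case .
  next
    case (Suc j)
    show ?case
    proof (cases "x \<le> X")
      case True
      then show ?thesis
        using Suc.IH[of x] Suc.prems h_pos by (simp add: add_increasing2)
    next
      case False
      have X': "X0 \<le> x" "1 \<le> x - a" "2 * a * 2 ^ n \<le> x - a"
        using False a_pos X0 \<open>0 < a * 2 ^ n\<close> unfolding X_def by linarith+
      have t: "(x - a) * \<bar>f x\<bar> \<le> a * 2 ^ n * M * rate n x + \<bar>r x\<bar>"
      proof (rule delay[OF X'(1)])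
        show "\<bar>f z\<bar> \<le> M * rate n z" if "x - a \<le> z" "z \<le> x - h" for z
          using Suc.prems X' that by (intro Suc.IH) (auto simp: algebra_simps)
      qed
      have "a * 2 ^ n * M * rate n x \<le> (x - a) / 2 * M * rate n x"
        using X' M0 by (intro mult_right_mono) auto
      moreover have "\<bar>r x\<bar> \<le> (x - a) * (M / 2 * rate n x)"
      proof -
        have "\<bar>r x\<bar> \<le> R * rate n x" using R Suc.prems by auto
        also have "\<dots> \<le> M / 2 * rate n x" by (intro mult_right_mono) (auto simp: M_def)
        also have "\<dots> \<le> (x - a) * (M / 2 * rate n x)"
          using mult_right_mono[OF X'(2), of "M / 2 * rate n x"] M0 by simp
        finally show ?thesis .
      qed
      moreover have "(x - a) / 2 * M * rate n x + (x - a) * (M / 2 * rate n x) = (x - a) * (M * rate n x)"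
        by (simp add: algebra_simps)
      ultimately have "(x - a) * \<bar>f x\<bar> \<le> (x - a) * (M * rate n x)"
        using t by linarith
      then show ?thesis
        by (rule mult_left_le_imp_le) (use X' in auto)
    qed
  qed note * = this
  have "\<bar>f x\<bar> \<le> M * rate n x" if "0 \<le> x" for x
  proof (rule *[OF that, of "nat \<lceil>x / h\<rceil>"])
    have "x / h \<le> real (nat \<lceil>x / h\<rceil>)" by linarith
    then show "x \<le> X + real (nat \<lceil>x / h\<rceil>) * h"
      using h_pos \<open>0 \<le> X\<close> by (simp add: pos_divide_le_eq)
  qed
  then show "\<exists>C\<ge>0. \<forall>x\<ge>0. \<bar>f x\<bar> \<le> C * rate n x"
    using M0 by blast
qed

lemma abs_integral_le_rate:
  assumes "f integrable_on {l..u}" "l \<le> u" "0 < n" "0 \<le> M"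
    and "\<And>z. l \<le> z \<Longrightarrow> z \<le> u \<Longrightarrow> \<bar>f z\<bar> \<le> M * rate n z"
  shows "\<bar>integral {l..u} f\<bar> \<le> M * (a / (real n * ln 2) * rate n l)"
proof -
  have "norm (integral {l..u} f) \<le> integral {l..u} (\<lambda>z. M * rate n z)"
    using assms by (intro integral_norm_bound_integral integrable_on_mult_right integrable_rate) auto
  also have "\<dots> = M * integral {l..u} (rate n)"
    by simp
  also have "\<dots> \<le> M * (a / (real n * ln 2) * rate n l)"
    using assms by (intro mult_left_mono integral_rate_le) auto
  finally show ?thesis by simp
qed

lemma integral_affine:
  assumes "l \<le> u"
  shows "((\<lambda>z. c * (z + h)) has_integral c * ((u - l) * ((u + l) / 2 + h))) {l..u}"
proof -
  have "((\<lambda>z. c * (z + h)) has_integral (c * (u\<^sup>2 / 2 + h * u) - c * (l\<^sup>2 / 2 + h * l))) {l..u}"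
    using assms
    by (intro fundamental_theorem_of_calculus)
       (auto intro!: derivative_eq_intros
           simp: has_real_derivative_iff_has_vector_derivative[symmetric] algebra_simps)
  then show ?thesis
    by (simp add: algebra_simps power2_eq_square add_divide_distrib diff_divide_distrib)
qed

text \<open>
  The increments of the equation for the sum are not affected when a multiple of \<open>x + h\<close> is subtracted.
\<close>

lemma increment_minus_affine:
  assumes int: "\<And>l u. 0 \<le> l \<Longrightarrow> s integrable_on {l..u}"
    and X0: "a \<le> X0"
    and incr: "\<And>x y. X0 \<le> x \<Longrightarrow> x \<le> y \<Longrightarrow> (y - a) * s y - r y - ((x - a) * s x - r x) =
       integral {x - a..y - a} s + integral {x - h..y - h} s"
    and xy: "X0 \<le> x" "x \<le> y"
  shows "(y - a) * (s y - c * (y + h)) - r y - ((x - a) * (s x - c * (x + h)) - r x) =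
      integral {x - a..y - a} (\<lambda>z. s z - c * (z + h)) + integral {x - h..y - h} (\<lambda>z. s z - c * (z + h))"
proof -
  have "integral {l..u} (\<lambda>z. s z - c * (z + h)) = integral {l..u} s - c * ((u - l) * ((u + l) / 2 + h))"
    if "0 \<le> l" "l \<le> u" for l u
    by (rule integral_unique[OF has_integral_diff[OF integrable_integral[OF int[OF that(1)]]
        integral_affine[OF that(2)]]])
  from this[of "x - a" "y - a"] this[of "x - h" "y - h"]
  have I: "integral {x - a..y - a} (\<lambda>z. s z - c * (z + h)) =
        integral {x - a..y - a} s - c * ((y - a - (x - a)) * ((y - a + (x - a)) / 2 + h))"
    "integral {x - h..y - h} (\<lambda>z. s z - c * (z + h)) =
        integral {x - h..y - h} s - c * ((y - h - (x - h)) * ((y - h + (x - h)) / 2 + h))"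
    using X0 xy h_le_a by auto
  have "(y - a) * (s y - c * (y + h)) - r y - ((x - a) * (s x - c * (x + h)) - r x) =
      ((y - a) * s y - r y - ((x - a) * s x - r x)) - c * ((y - a) * (y + h) - (x - a) * (x + h))"
    by (simp add: algebra_simps)
  also have "(y - a) * (y + h) - (x - a) * (x + h) =
      (y - a - (x - a)) * ((y - a + (x - a)) / 2 + h) + (y - h - (x - h)) * ((y - h + (x - h)) / 2 + h)"
    by (simp add: field_simps)
  finally show ?thesis
    unfolding incr[OF xy] I by (simp add: distrib_left)
qed

text \<open>
  Let \<open>q j\<close> be the ratio \<open>s(x) / (x + h)\<close> at the point \<open>x = X + j h\<close>. On the window
  \<open>[X + j h, X + (j + 1) h]\<close>, the distance from \<open>s(y)\<close> to \<open>q j * (y + h)\<close> is governed by the two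
  preceding windows only, because the integrals in the increment of the equation extend over subsets of
  \<open>[X + j h - a, X + j h]\<close>, and \<open>a \<le> 2 h\<close>. The division by \<open>y - a\<close> makes the distance decay geometrically.
\<close>

lemma window_ratios:
  assumes bdd: "\<And>X. \<exists>K. \<forall>x. 0 \<le> x \<and> x \<le> X \<longrightarrow> \<bar>s x\<bar> \<le> K"
    and int: "\<And>l u. 0 \<le> l \<Longrightarrow> s integrable_on {l..u}"
    and r: "rapid r" and X0: "a \<le> X0"
    and incr: "\<And>x y. X0 \<le> x \<Longrightarrow> x \<le> y \<Longrightarrow> (y - a) * s y - r y - ((x - a) * s x - r x) =
       integral {x - a..y - a} s + integral {x - h..y - h} s"
  obtains X C q where "X0 \<le> X" "0 \<le> C"
    "\<And>j y. X + real j * h \<le> y \<Longrightarrow> y \<le> X + real (Suc j) * h \<Longrightarrow> \<bar>s y - q j * (y + h)\<bar> \<le> C * rate n h ^ j"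
    "\<And>j. \<bar>q (Suc j) - q j\<bar> \<le> C / h * rate n h ^ j"
proof -
  obtain R where R: "R \<ge> 0" "\<And>x. x \<ge> 0 \<Longrightarrow> \<bar>r x\<bar> \<le> R * rate n x"
    using r unfolding rapid_def by blast
  define \<mu> where "\<mu> = rate n h"
  have \<mu>: "0 < \<mu>" "\<mu> \<le> 1" using rate_le_1[of h n] h_pos by (auto simp: \<mu>_def)
  have \<mu>2: "1 \<le> 2 ^ n * \<mu>"
    using rate_antimono[OF h_le_a, of n] by (simp add: \<mu>_def rate_a field_simps)
  \<comment> \<open>large enough for the factor \<open>1 / (y - a)\<close> to outweigh \<open>8 * h * 4 ^ n + 2\<close>; the power \<open>4 ^ n\<close>
     bounds \<open>1 / \<mu>\<^sup>2\<close> and accounts for going back two windows\<close>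
  define X where "X = X0 + a + 16 * h * 4 ^ n + 4"
  have h4: "0 < 16 * h * 4 ^ n" using h_pos by simp
  have X: "X0 \<le> X" "0 \<le> X" "16 * h * 4 ^ n + 4 \<le> X - a"
    using X0 a_pos h4 unfolding X_def by linarith+
  define xj where "xj = (\<lambda>j :: nat. X + real j * h)"
  have xj_Suc: "xj (Suc j) = xj j + h" for j by (simp add: xj_def algebra_simps)
  have xj_ge: "X \<le> xj j" for j using h_pos by (simp add: xj_def)
  define q where "q = (\<lambda>j. s (xj j) / (xj j + h))"
  have q0: "s (xj j) - q j * (xj j + h) = 0" for j
    using xj_ge[of j] X h_pos by (simp add: q_def)
  obtain K where K: "\<And>x. 0 \<le> x \<Longrightarrow> x \<le> X + 2 * h \<Longrightarrow> \<bar>s x\<bar> \<le> K"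
    using bdd by blast
  have K0: "0 \<le> K" using K[of 0] X h_pos by simp
  define K' where "K' = K + (max \<bar>q 0\<bar> \<bar>q 1\<bar>) * (X + 3 * h)"
  have K'0: "0 \<le> K'" using K0 X h_pos by (simp add: K'_def)
  define C where "C = max R (K' / \<mu>)"
  have "K' / \<mu> \<le> C" by (simp add: C_def)
  then have "K' \<le> C * \<mu>" using \<mu> by (simp add: pos_divide_le_eq)
  then have C: "0 \<le> C" "R \<le> C" "K' \<le> C * \<mu>"
    using R by (auto simp: C_def)
  have win: "\<bar>s y - q j * (y + h)\<bar> \<le> C * \<mu> ^ j" if "xj j \<le> y" "y \<le> xj (Suc j)" for j y
    using that
  proof (induction j arbitrary: y rule: less_induct)
    case (less j)
    have y: "X \<le> y" "0 \<le> y + h" using less.prems xj_ge[of j] X h_pos by linarith+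
    show ?case
    proof (cases "j < 2")
      case True
      then have j: "j = 0 \<or> j = 1" by auto
      have y2: "y \<le> X + 2 * h" using less.prems j h_pos by (auto simp: xj_def)
      have "\<bar>s y - q j * (y + h)\<bar> \<le> \<bar>s y\<bar> + \<bar>q j\<bar> * (y + h)"
        using abs_triangle_ineq4[of "s y" "q j * (y + h)"] y by (simp add: abs_mult)
      also have "\<dots> \<le> K'"
      proof -
        have "\<bar>q j\<bar> \<le> max \<bar>q 0\<bar> \<bar>q 1\<bar>" "y + h \<le> X + 3 * h" "\<bar>s y\<bar> \<le> K"
          using j y y2 X K[of y] by auto
        then show ?thesis
          unfolding K'_def using y by (intro add_mono[OF _ mult_mono]) auto
      qed
      also have "\<dots> \<le> C * \<mu> ^ j"
        using j C \<mu> mult_left_mono[of \<mu> 1 C] by auto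
      finally show ?thesis .
    next
      case False
      then obtain i where i: "j = Suc (Suc i)"
        by (metis add_2_eq_Suc le_add_diff_inverse linorder_not_less)
      have IH0: "\<bar>s z - q i * (z + h)\<bar> \<le> C * \<mu> ^ i" if "xj i \<le> z" "z \<le> xj i + h" for z
        using less.IH[of i z] that i by (simp add: xj_Suc)
      have IH1: "\<bar>s z - q (Suc i) * (z + h)\<bar> \<le> C * \<mu> ^ Suc i" if "xj i + h \<le> z" "z \<le> xj i + h + h" for z
        using less.IH[of "Suc i" z] that i by (simp add: xj_Suc)
      let ?x0 = "xj i" and ?x1 = "xj i + h" and ?x2 = "xj i + h + h"
      have x0: "0 \<le> ?x0" using xj_ge[of i] X by linarith
      have q1: "s ?x1 = q (Suc i) * (?x1 + h)" and q2: "s ?x2 = q j * (?x2 + h)"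
        using q0[of "Suc i"] q0[of j] by (auto simp: xj_Suc i)
      have d1: "\<bar>q (Suc i) - q i\<bar> * (?x1 + h) \<le> C * \<mu> ^ i"
        using IH0[of ?x1] h_pos x0 unfolding q1 by (simp add: left_diff_distrib[symmetric] abs_mult)
      have d2: "\<bar>q j - q (Suc i)\<bar> * (?x2 + h) \<le> C * \<mu> ^ Suc i"
        using IH1[of ?x2] h_pos x0 unfolding q2 by (simp add: left_diff_distrib[symmetric] abs_mult)
      have mono: "C * \<mu> ^ Suc i \<le> C * \<mu> ^ i"
        using \<mu> C mult_left_mono[of "\<mu> * \<mu> ^ i" "1 * \<mu> ^ i" C] by (simp add: mult_right_mono)
      define B where "B = 4 * (C * \<mu> ^ i)"
      have B0: "0 \<le> B" using C \<mu> by (simp add: B_def)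
      have past: "\<bar>s z - q j * (z + h)\<bar> \<le> B" if z: "?x0 \<le> z" "z \<le> ?x2" for z
      proof -
        have e2: "\<bar>q j - q (Suc i)\<bar> * (z + h) \<le> C * \<mu> ^ Suc i"
          using d2 mult_left_mono[of "z + h" "?x2 + h" "\<bar>q j - q (Suc i)\<bar>"] z by linarith
        have t: "\<bar>s z - q j * (z + h)\<bar> \<le> \<bar>s z - q (Suc i) * (z + h)\<bar> + \<bar>q j - q (Suc i)\<bar> * (z + h)"
        proof -
          have "s z - q j * (z + h) = (s z - q (Suc i) * (z + h)) - (q j - q (Suc i)) * (z + h)"
            by (simp add: algebra_simps)
          moreover have "\<bar>(q j - q (Suc i)) * (z + h)\<bar> = \<bar>q j - q (Suc i)\<bar> * (z + h)"
            using z x0 h_pos by (simp add: abs_mult)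
          ultimately show ?thesis by linarith
        qed
        show ?thesis
        proof (cases "z \<le> ?x1")
          case True
          have e1: "\<bar>q (Suc i) - q i\<bar> * (z + h) \<le> C * \<mu> ^ i"
            using d1 mult_left_mono[of "z + h" "?x1 + h" "\<bar>q (Suc i) - q i\<bar>"] True by linarith
          have "s z - q (Suc i) * (z + h) = (s z - q i * (z + h)) - (q (Suc i) - q i) * (z + h)"
            by (simp add: algebra_simps)
          moreover have "\<bar>(q (Suc i) - q i) * (z + h)\<bar> = \<bar>q (Suc i) - q i\<bar> * (z + h)"
            using z x0 h_pos by (simp add: abs_mult)
          ultimately have "\<bar>s z - q (Suc i) * (z + h)\<bar> \<le> \<bar>s z - q i * (z + h)\<bar> + \<bar>q (Suc i) - q i\<bar> * (z + h)"
            by linarith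
          then show ?thesis
            using t e1 e2 IH0[OF z(1) True] mono B0 unfolding B_def by linarith
        next
          case False
          then show ?thesis
            using t e2 IH1[of z] z mono B0 unfolding B_def by linarith
        qed
      qed
      have xj: "xj j = ?x2" by (simp add: i xj_Suc)
      have yj: "?x2 \<le> y" "y \<le> ?x2 + h" using less.prems by (auto simp: xj xj_Suc)
      have int': "(\<lambda>z. s z - q j * (z + h)) integrable_on {l..u}" if "0 \<le> l" for l u
        by (intro integrable_diff int[OF that] integrable_continuous_interval continuous_intros)
      have I: "\<bar>integral {?x2 - c..y - c} (\<lambda>z. s z - q j * (z + h))\<bar> \<le> B * h"
        if c: "h \<le> c" "c \<le> 2 * h" for c
      proof -
        have "\<bar>integral {?x2 - c..y - c} (\<lambda>z. s z - q j * (z + h))\<bar> \<le> B * (y - c - (?x2 - c))"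
          by (rule abs_integral_le_const[OF int']) (use c yj x0 in \<open>auto intro!: past\<close>)
        also have "\<dots> \<le> B * h" using yj B0 by (intro mult_left_mono) auto
        finally show ?thesis .
      qed
      have eq: "(y - a) * (s y - q j * (y + h)) - r y - (0 - r ?x2) =
        integral {?x2 - a..y - a} (\<lambda>z. s z - q j * (z + h))
            + integral {?x2 - h..y - h} (\<lambda>z. s z - q j * (z + h))"
        using increment_minus_affine[OF int X0 incr, of ?x2 y "q j"] yj xj_ge[of j] X(1) q2
        by (simp add: xj)
      have j\<mu>: "rate n z \<le> \<mu> ^ j" if "?x2 \<le> z" for z
      proof -
        have "xj j \<le> z" using that xj by simp
        then have "real j * h \<le> z" using X(2) unfolding xj_def by linarith
        from rate_antimono[OF this, of n] show ?thesis by (simp add: \<mu>_def rate_mult_nat)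
      qed
      have rb: "\<bar>r z\<bar> \<le> C * \<mu> ^ j" if "?x2 \<le> z" for z
      proof -
        have "0 \<le> z" using that x0 h_pos by linarith
        then have "\<bar>r z\<bar> \<le> R * rate n z" by (rule R(2))
        also have "\<dots> \<le> C * \<mu> ^ j" by (intro mult_mono C j\<mu> that) auto
        finally show ?thesis .
      qed
      have B_le: "B \<le> 4 * 4 ^ n * (C * \<mu> ^ j)"
      proof -
        have "1 * 1 \<le> (2 ^ n * \<mu>) * (2 ^ n * \<mu>)"
          using \<mu>2 by (intro mult_mono) auto
        also have "\<dots> = 4 ^ n * \<mu> ^ 2"
          by (simp add: power2_eq_square power_mult_distrib[symmetric] mult_ac)
        finally have "1 * (C * \<mu> ^ i) \<le> 4 ^ n * \<mu> ^ 2 * (C * \<mu> ^ i)"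
          using C \<mu> by (intro mult_right_mono) auto
        then show ?thesis
          by (simp add: B_def i power2_eq_square mult_ac)
      qed
      have "(y - a) * \<bar>s y - q j * (y + h)\<bar> \<le> 2 * (B * h) + 2 * (C * \<mu> ^ j)"
      proof -
        have "\<bar>(y - a) * (s y - q j * (y + h))\<bar> \<le> 2 * (B * h) + 2 * (C * \<mu> ^ j)"
          using eq I[of a] I[of h] a_le_2h h_le_a h_pos rb[of y] rb[of ?x2] yj by linarith
        moreover have "0 \<le> y - a" using y X h4 by linarith
        ultimately show ?thesis by (simp add: abs_mult)
      qed
      also have "\<dots> \<le> (8 * h * 4 ^ n + 2) * (C * \<mu> ^ j)"
        using mult_right_mono[OF B_le, of h] h_pos by (simp add: algebra_simps)
      also have "\<dots> \<le> (y - a) * (C * \<mu> ^ j)"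
        using X(3) y(1) h4 C \<mu> by (intro mult_right_mono) auto
      finally show ?thesis
        by (rule mult_left_le_imp_le) (use y(1) X(3) h4 in linarith)
    qed
  qed
  have "\<bar>q (Suc j) - q j\<bar> \<le> C / h * \<mu> ^ j" for j
  proof -
    have "\<bar>s (xj (Suc j)) - q j * (xj (Suc j) + h)\<bar> \<le> C * \<mu> ^ j"
      by (rule win) (use h_pos xj_Suc in auto)
    moreover have "s (xj (Suc j)) = q (Suc j) * (xj (Suc j) + h)"
      using q0[of "Suc j"] by simp
    moreover have p: "h \<le> xj (Suc j) + h"
      using xj_ge[of "Suc j"] X by linarith
    ultimately have "\<bar>q (Suc j) - q j\<bar> * (xj (Suc j) + h) \<le> C * \<mu> ^ j"
      using h_pos by (simp add: left_diff_distrib[symmetric] abs_mult)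
    moreover have "\<bar>q (Suc j) - q j\<bar> * h \<le> \<bar>q (Suc j) - q j\<bar> * (xj (Suc j) + h)"
      using p by (intro mult_left_mono) auto
    ultimately show ?thesis
      using h_pos by (simp add: field_simps)
  qed
  then show ?thesis
    using that[of X C q] X C win unfolding xj_def \<mu>_def by blast
qed

lemma nonneg_of_rate_bound: "0 \<le> M" if "\<bar>y\<bar> \<le> M * rate n x"
proof (rule mult_right_le_imp_le)
  show "0 * rate n x \<le> M * rate n x"
    using order_trans[OF abs_ge_zero that] by simp
qed simp

text \<open>
  The equation for the sum enters through its increments from \<open>x\<close> to \<open>y\<close>, so that additive constants
  (such as integrals over a fixed initial interval) play no role.
\<close>

lemma affine_asymptotics_rapid:
  assumes bdd: "\<And>X. \<exists>K. \<forall>x. 0 \<le> x \<and> x \<le> X \<longrightarrow> \<bar>s x\<bar> \<le> K"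
    and int: "\<And>l u. 0 \<le> l \<Longrightarrow> s integrable_on {l..u}"
    and r: "rapid r" and X0: "a \<le> X0"
    and incr: "\<And>x y. X0 \<le> x \<Longrightarrow> x \<le> y \<Longrightarrow> (y - a) * s y - r y - ((x - a) * s x - r x) =
       integral {x - a..y - a} s + integral {x - h..y - h} s"
  shows "\<exists>\<alpha>. rapid (\<lambda>x. s x - \<alpha> * (x + h))"
proof -
  have one: "\<exists>\<alpha> C. 0 \<le> C \<and> (\<forall>x\<ge>0. \<bar>s x - \<alpha> * (x + h)\<bar> \<le> C * ((x + h) * rate n x))" if n: "0 < n" for n
  proof -
    obtain X C q where X: "X0 \<le> X" and C: "0 \<le> C" and
      win: "\<And>j y. X + real j * h \<le> y \<Longrightarrow> y \<le> X + real (Suc j) * h \<Longrightarrow> \<bar>s y - q j * (y + h)\<bar> \<le> C * rate n h ^ j"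
      and q: "\<And>j. \<bar>q (Suc j) - q j\<bar> \<le> C / h * rate n h ^ j"
      using window_ratios[OF bdd int r X0 incr, of n] by metis
    define \<mu> where "\<mu> = rate n h"
    have "\<mu> < 2 powr 0"
      using n h_pos a_pos unfolding \<mu>_def rate_def by (intro powr_less_mono) auto
    then have \<mu>: "0 < \<mu>" "\<mu> < 1" by (auto simp: \<mu>_def)
    obtain \<alpha> where \<alpha>: "\<And>j. \<bar>q j - \<alpha>\<bar> \<le> C / h / (1 - \<mu>) * \<mu> ^ j"
      using geometric_Cauchy_limit[OF \<mu>, of q "C / h"] q unfolding \<mu>_def by blast
    have X00: "0 \<le> X" using X X0 a_pos by linarith
    obtain K where K: "\<And>x. 0 \<le> x \<Longrightarrow> x \<le> X \<Longrightarrow> \<bar>s x\<bar> \<le> K"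
      using bdd by blast
    have K0: "0 \<le> K" using K[of 0] X00 by simp
    define D where "D = C / h + C / h / (1 - \<mu>)"
    have D0: "0 \<le> D" using C h_pos \<mu> by (simp add: D_def)
    define D1 where "D1 = D / rate n (X + h)"
    define D2 where "D2 = (K / h + \<bar>\<alpha>\<bar>) / rate n X"
    have D12: "0 \<le> D1" "0 \<le> D2" using D0 K0 h_pos by (auto simp: D1_def D2_def)
    have "\<bar>s x - \<alpha> * (x + h)\<bar> \<le> (D1 + D2) * ((x + h) * rate n x)" if x: "0 \<le> x" for x
    proof (cases "X \<le> x")
      case True
      define j where "j = nat \<lfloor>(x - X) / h\<rfloor>"
      have "real j \<le> (x - X) / h" "(x - X) / h \<le> real (Suc j)"
        using True h_pos unfolding j_def by (auto, linarith)
      then have j: "X + real j * h \<le> x" "x \<le> X + real (Suc j) * h"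
        using h_pos by (auto simp: field_simps)
      have "\<bar>s x - \<alpha> * (x + h)\<bar> \<le> \<bar>s x - q j * (x + h)\<bar> + \<bar>q j - \<alpha>\<bar> * (x + h)"
      proof -
        have "s x - \<alpha> * (x + h) = (s x - q j * (x + h)) + (q j - \<alpha>) * (x + h)"
          by (simp add: algebra_simps)
        moreover have "\<bar>(q j - \<alpha>) * (x + h)\<bar> = \<bar>q j - \<alpha>\<bar> * (x + h)"
          using x h_pos by (simp add: abs_mult)
        ultimately show ?thesis by linarith
      qed
      also have "\<dots> \<le> C * \<mu> ^ j + C / h / (1 - \<mu>) * \<mu> ^ j * (x + h)"
        using win[OF j] \<alpha>[of j] x h_pos by (intro add_mono mult_right_mono) (auto simp: \<mu>_def)
      also have "C * \<mu> ^ j \<le> C / h * \<mu> ^ j * (x + h)"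
        using mult_left_mono[of h "x + h" "C / h * \<mu> ^ j"] C h_pos \<mu> x by simp
      also have "C / h * \<mu> ^ j * (x + h) + C / h / (1 - \<mu>) * \<mu> ^ j * (x + h) = D * (x + h) * \<mu> ^ j"
        by (simp add: D_def algebra_simps)
      also have "\<mu> ^ j \<le> rate n x / rate n (X + h)"
      proof -
        have "\<mu> ^ j = rate n (real j * h)" by (simp add: \<mu>_def rate_mult_nat)
        also have "\<dots> \<le> rate n (x - (X + h))"
          using j by (intro rate_antimono) (auto simp: algebra_simps)
        finally show ?thesis by (simp add: rate_diff)
      qed
      finally have "\<bar>s x - \<alpha> * (x + h)\<bar> \<le> D * (x + h) * (rate n x / rate n (X + h))"
        using D0 x h_pos by (simp add: mult_left_mono)
      also have "\<dots> = D1 * ((x + h) * rate n x)"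
        by (simp add: D1_def)
      also have "\<dots> \<le> (D1 + D2) * ((x + h) * rate n x)"
        using D12 x h_pos by (intro mult_right_mono) auto
      finally show ?thesis .
    next
      case False
      have "\<bar>s x - \<alpha> * (x + h)\<bar> \<le> \<bar>s x\<bar> + \<bar>\<alpha>\<bar> * (x + h)"
        using abs_triangle_ineq4[of "s x" "\<alpha> * (x + h)"] x h_pos by (simp add: abs_mult)
      also have "\<dots> \<le> K / h * (x + h) + \<bar>\<alpha>\<bar> * (x + h)"
        using K[of x] False x h_pos K0 mult_left_mono[of h "x + h" "K / h"] by simp
      also have "\<dots> = D2 * ((x + h) * rate n X)"
        by (simp add: D2_def field_simps less_imp_neq[OF rate_pos, symmetric])
      also have "\<dots> \<le> (D1 + D2) * ((x + h) * rate n x)"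
        using D12 x h_pos False by (intro mult_mono rate_antimono) auto
      finally show ?thesis .
    qed
    then show ?thesis using D12 by (intro exI[of _ \<alpha>] exI[of _ "D1 + D2"]) auto
  qed
  \<comment> \<open>the constant obtained for \<open>n = 1\<close> works for all \<open>n\<close>, because it is the limit of \<open>s(x) / (x + h)\<close>\<close>
  obtain \<alpha> C1 where C1: "0 \<le> C1" "\<And>x. x \<ge> 0 \<Longrightarrow> \<bar>s x - \<alpha> * (x + h)\<bar> \<le> C1 * ((x + h) * rate 1 x)"
    using one[of 1] by auto
  have "rapid (\<lambda>x. s x - \<alpha> * (x + h))"
    unfolding rapid_def
  proof
    fix n
    obtain \<beta> C where C: "0 \<le> C" "\<And>x. x \<ge> 0 \<Longrightarrow> \<bar>s x - \<beta> * (x + h)\<bar> \<le> C * ((x + h) * rate (Suc n) x)"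
      using one[of "Suc n"] by auto
    have "\<bar>\<alpha> - \<beta>\<bar> \<le> (C1 + C) * rate 1 x" if x: "0 \<le> x" for x
    proof -
      have "\<bar>\<alpha> - \<beta>\<bar> * (x + h) = \<bar>(s x - \<beta> * (x + h)) - (s x - \<alpha> * (x + h))\<bar>"
        using x h_pos by (simp add: left_diff_distrib[symmetric] abs_mult)
      also have "\<dots> \<le> C1 * ((x + h) * rate 1 x) + C * ((x + h) * rate (Suc n) x)"
        using C1(2)[OF x] C(2)[OF x] by linarith
      also have "C * ((x + h) * rate (Suc n) x) \<le> C * ((x + h) * rate 1 x)"
        using C x h_pos by (intro mult_left_mono rate_mono_index) auto
      finally have "\<bar>\<alpha> - \<beta>\<bar> * (x + h) \<le> ((C1 + C) * rate 1 x) * (x + h)"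
        by (simp add: algebra_simps)
      then show ?thesis
        by (rule mult_right_le_imp_le) (use x h_pos in auto)
    qed
    moreover have "((\<lambda>x. (C1 + C) * rate 1 x) \<longlongrightarrow> 0) at_top"
      by (rule tendsto_mult_right_zero[OF rate_tendsto])
    ultimately have "\<bar>\<alpha> - \<beta>\<bar> \<le> 0"
      by (intro tendsto_lowerbound[of "\<lambda>x. (C1 + C) * rate 1 x" 0 at_top])
         (auto intro: eventually_mono[OF eventually_ge_at_top[of 0]])
    then have "\<alpha> = \<beta>" by simp
    show "\<exists>C\<ge>0. \<forall>x\<ge>0. \<bar>s x - \<alpha> * (x + h)\<bar> \<le> C * rate n x"
    proof (intro exI[of _ "C * (3 * a)"] conjI allI impI)
      fix x :: real assume x: "0 \<le> x"
      have "\<bar>s x - \<alpha> * (x + h)\<bar> \<le> C * ((x + h) * rate 1 x) * rate n x"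
        using C(2)[OF x] rate_Suc[of n x] by (simp add: \<open>\<alpha> = \<beta>\<close> mult_ac)
      also have "\<dots> \<le> C * (3 * a) * rate n x"
        using linear_rate_le[OF x] C by (intro mult_right_mono mult_left_mono) auto
      finally show "\<bar>s x - \<alpha> * (x + h)\<bar> \<le> C * (3 * a) * rate n x" .
    qed (use C a_pos in auto)
  qed
  then show ?thesis by blast
qed

lemma affine_asymptotics:
  assumes bdd: "\<And>X. \<exists>K. \<forall>x. 0 \<le> x \<and> x \<le> X \<longrightarrow> \<bar>s x\<bar> \<le> K"
    and int: "\<And>l u. 0 \<le> l \<Longrightarrow> s integrable_on {l..u}"
    and r: "superexp \<eta> r" and \<eta>: "0 < \<eta>" and X0: "a \<le> X0"
    and incr: "\<And>x y. X0 \<le> x \<Longrightarrow> x \<le> y \<Longrightarrow> (y - a) * s y - r y - ((x - a) * s x - r x) =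
       integral {x - a..y - a} s + integral {x - h..y - h} s"
  shows "\<exists>\<alpha>. superexp \<eta> (\<lambda>x. s x - \<alpha> * (x + h))"
proof -
  note rr = superexp_imp_rapid[OF r]
  obtain \<alpha> where E: "rapid (\<lambda>x. s x - \<alpha> * (x + h))"
    using affine_asymptotics_rapid[OF bdd int rr X0 incr] by blast
  define E where "E = (\<lambda>x. s x - \<alpha> * (x + h))"
  have rE: "rapid E" using E by (simp add: E_def)
  have X00: "0 \<le> X0" using X0 a_pos by linarith
  have intE: "E integrable_on {l..u}" if "0 \<le> l" for l u
    unfolding E_def by (intro integrable_diff int[OF that] integrable_continuous_interval continuous_intros)
  have "superexp \<eta> E"
  proof (rule superexp_of_tail[OF rE r \<eta> X00])
    fix n M x
    assume n: "0 < n" and x: "X0 \<le> x" and M: "\<And>z. x - a \<le> z \<Longrightarrow> \<bar>E z\<bar> \<le> M * rate n z"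
    have x0: "0 \<le> x - a" using x X0 by simp
    have M0: "0 \<le> M"
      by (rule nonneg_of_rate_bound[OF M[of x]]) (use a_pos in auto)
    let ?c = "a / (real n * ln 2)"
    have c0: "0 \<le> ?c" using a_pos by simp
    have bound: "(x - a) * \<bar>E x\<bar>
        \<le> (2 * ?c * 2 ^ n * M * rate n x + \<bar>r x\<bar>) + (\<bar>(y + h) * E y\<bar> + \<bar>(y + h) * r y\<bar> / h)"
      if y: "x \<le> y" for y
    proof -
      have eq: "(y - a) * E y - r y - ((x - a) * E x - r x) = integral {x - a..y - a} E
          + integral {x - h..y - h} E"
        using increment_minus_affine[OF int X0 incr x y, of \<alpha>] unfolding E_def by simp
      have I1: "\<bar>integral {x - a..y - a} E\<bar> \<le> M * (?c * rate n (x - a))"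
        using n M0 y x0 by (intro abs_integral_le_rate intE) (auto intro!: M)
      have "\<bar>integral {x - h..y - h} E\<bar> \<le> M * (?c * rate n (x - h))"
        using n M0 y x0 h_le_a by (intro abs_integral_le_rate intE) (auto intro!: M)
      also have "\<dots> \<le> M * (?c * rate n (x - a))"
        using M0 c0 h_le_a by (intro mult_left_mono rate_antimono) auto
      finally have I2: "\<bar>integral {x - h..y - h} E\<bar> \<le> M * (?c * rate n (x - a))" .
      have "\<bar>(y - a) * E y\<bar> \<le> \<bar>(y + h) * E y\<bar>"
        unfolding abs_mult using y x0 h_pos a_pos by (intro mult_right_mono) auto
      moreover have "\<bar>r y\<bar> \<le> \<bar>(y + h) * r y\<bar> / h"
        unfolding pos_le_divide_eq[OF h_pos] abs_mult
        using mult_right_mono[of h "\<bar>y + h\<bar>" "\<bar>r y\<bar>"] y x0 a_pos by (simp add: mult.commute)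
      moreover have "\<bar>(x - a) * E x\<bar> = (x - a) * \<bar>E x\<bar>"
        using x0 by (simp add: abs_mult)
      moreover have "M * (?c * rate n (x - a)) = ?c * 2 ^ n * M * rate n x"
        by (simp add: rate_shift)
      ultimately show ?thesis
        using eq I1 I2 by linarith
    qed
    \<comment> \<open>letting \<open>y\<close> tend to infinity removes the terms at \<open>y\<close>\<close>
    have lim: "((\<lambda>y. (2 * ?c * 2 ^ n * M * rate n x + \<bar>r x\<bar>) + (\<bar>(y + h) * E y\<bar> + \<bar>(y + h) * r y\<bar> / h))
        \<longlongrightarrow> (2 * ?c * 2 ^ n * M * rate n x + \<bar>r x\<bar>) + (\<bar>0\<bar> + \<bar>0\<bar> / h)) at_top"
      using h_pos by (intro tendsto_intros rapid_tendsto rE rr) auto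
    show "(x - a) * \<bar>E x\<bar> \<le> 2 * ?c * 2 ^ n * M * rate n x + \<bar>r x\<bar>"
      using tendsto_lowerbound[OF lim, of "(x - a) * \<bar>E x\<bar>"] bound
      by (simp add: eventually_mono[OF eventually_ge_at_top[of x]])
  qed
  then show ?thesis by (auto simp: E_def)
qed

lemma delay_decay:
  assumes bdd: "\<And>X. \<exists>K. \<forall>x. 0 \<le> x \<and> x \<le> X \<longrightarrow> \<bar>f x\<bar> \<le> K"
    and int: "\<And>l u. 0 \<le> l \<Longrightarrow> f integrable_on {l..u}"
    and r: "superexp \<eta> r" and \<eta>: "0 < \<eta>" and X0: "a \<le> X0"
    and eq: "\<And>x. X0 \<le> x \<Longrightarrow> (x - a) * f x = r x - integral {x - a..x - h} f"
  shows "superexp \<eta> f"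
proof -
  have X00: "0 \<le> X0" using X0 a_pos by linarith
  have rf: "rapid f"
  proof (rule rapid_of_delay[OF bdd superexp_imp_rapid[OF r] X00])
    fix n M x
    assume x: "X0 \<le> x" and M: "\<And>z. x - a \<le> z \<Longrightarrow> z \<le> x - h \<Longrightarrow> \<bar>f z\<bar> \<le> M * rate n z"
    have x0: "0 \<le> x - a" using x X0 by simp
    have M0: "0 \<le> M"
      by (rule nonneg_of_rate_bound[OF M[of "x - a"]]) (use h_le_a in auto)
    have "\<bar>f z\<bar> \<le> M * (2 ^ n * rate n x)" if "x - a \<le> z" "z \<le> x - h" for z
      using M[OF that] mult_left_mono[OF rate_antimono[OF that(1), of n] M0] by (simp add: rate_shift)
    then have "\<bar>integral {x - a..x - h} f\<bar> \<le> M * (2 ^ n * rate n x) * (x - h - (x - a))"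
      using h_le_a x0 by (intro abs_integral_le_const int) auto
    also have "\<dots> \<le> M * (2 ^ n * rate n x) * a"
      using h_pos M0 by (intro mult_left_mono) auto
    finally have "\<bar>integral {x - a..x - h} f\<bar> \<le> a * 2 ^ n * M * rate n x"
      by (simp add: mult_ac)
    moreover have "\<bar>(x - a) * f x\<bar> = (x - a) * \<bar>f x\<bar>"
      using x0 by (simp add: abs_mult)
    ultimately show "(x - a) * \<bar>f x\<bar> \<le> a * 2 ^ n * M * rate n x + \<bar>r x\<bar>"
      using eq[OF x] by linarith
  qed
  show ?thesis
  proof (rule superexp_of_tail[OF rf r \<eta> X00])
    fix n M x
    assume n: "0 < n" and x: "X0 \<le> x" and M: "\<And>z. x - a \<le> z \<Longrightarrow> \<bar>f z\<bar> \<le> M * rate n z"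
    have x0: "0 \<le> x - a" using x X0 by simp
    have M0: "0 \<le> M"
      by (rule nonneg_of_rate_bound[OF M[of x]]) (use a_pos in auto)
    let ?c = "a / (real n * ln 2)"
    have "\<bar>integral {x - a..x - h} f\<bar> \<le> M * (?c * rate n (x - a))"
      using n M0 x0 h_le_a by (intro abs_integral_le_rate int) (auto intro!: M)
    also have "\<dots> = ?c * 2 ^ n * M * rate n x"
      by (simp add: rate_shift)
    finally have "\<bar>integral {x - a..x - h} f\<bar> \<le> ?c * 2 ^ n * M * rate n x" .
    moreover have "\<bar>(x - a) * f x\<bar> = (x - a) * \<bar>f x\<bar>"
      using x0 by (simp add: abs_mult)
    moreover have "0 \<le> ?c * 2 ^ n * M * rate n x"
      using M0 a_pos by simp
    ultimately show "(x - a) * \<bar>f x\<bar> \<le> 2 * ?c * 2 ^ n * M * rate n x + \<bar>r x\<bar>"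
      using eq[OF x] by linarith
  qed
qed

text \<open>
  The system of the mean values, with forcing terms \<open>r1\<close> and \<open>r2\<close>.
\<close>

lemma coupled_asymptotics:
  assumes bddu: "\<And>X. \<exists>K. \<forall>x. 0 \<le> x \<and> x \<le> X \<longrightarrow> \<bar>u x\<bar> \<le> K"
    and bddv: "\<And>X. \<exists>K. \<forall>x. 0 \<le> x \<and> x \<le> X \<longrightarrow> \<bar>v x\<bar> \<le> K"
    and intu: "\<And>l r. 0 \<le> l \<Longrightarrow> u integrable_on {l..r}"
    and intv: "\<And>l r. 0 \<le> l \<Longrightarrow> v integrable_on {l..r}"
    and r: "superexp \<eta> r1" "superexp \<eta> r2" and \<eta>: "0 < \<eta>" and X0: "2 * a - h \<le> X0"
    and equ: "\<And>x. X0 \<le> x \<Longrightarrow> (x - a) * u x = integral {0..x - a} u + integral {a - h..x - h} v + r1 x"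
    and eqv: "\<And>x. X0 \<le> x \<Longrightarrow> (x - a) * v x = integral {a - h..x - a} v + integral {0..x - h} u + r2 x"
  shows "\<exists>c. superexp \<eta> (\<lambda>x. u x - c * (x + h)) \<and> superexp \<eta> (\<lambda>x. v x - c * (x + h))"
proof -
  have X0a: "a \<le> X0" using X0 h_le_a by linarith
  have split: "integral {l..r} f = integral {l..m} f + integral {m..r} f"
    if "\<And>l r. 0 \<le> l \<Longrightarrow> f integrable_on {l..r}" "0 \<le> l" "l \<le> m" "m \<le> r" for f :: "real \<Rightarrow> real" and l m r
    using Henstock_Kurzweil_Integration.integral_combine[of l m r f] that by auto
  have bdd2: "\<exists>K. \<forall>x. 0 \<le> x \<and> x \<le> X \<longrightarrow> \<bar>u x + v x\<bar> \<le> K"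
    "\<exists>K. \<forall>x. 0 \<le> x \<and> x \<le> X \<longrightarrow> \<bar>u x - v x\<bar> \<le> K" for X
  proof -
    obtain K L where K: "\<And>x. 0 \<le> x \<Longrightarrow> x \<le> X \<Longrightarrow> \<bar>u x\<bar> \<le> K" "\<And>x. 0 \<le> x \<Longrightarrow> x \<le> X \<Longrightarrow> \<bar>v x\<bar> \<le> L"
      using bddu[of X] bddv[of X] by blast
    show "\<exists>K. \<forall>x. 0 \<le> x \<and> x \<le> X \<longrightarrow> \<bar>u x + v x\<bar> \<le> K"
      "\<exists>K. \<forall>x. 0 \<le> x \<and> x \<le> X \<longrightarrow> \<bar>u x - v x\<bar> \<le> K"
      using K by (auto intro!: exI[of _ "K + L"] order_trans[OF abs_triangle_ineq]
          order_trans[OF abs_triangle_ineq4] add_mono)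
  qed
  have "\<exists>\<alpha>. superexp \<eta> (\<lambda>x. (u x + v x) - \<alpha> * (x + h))"
  proof (rule affine_asymptotics[OF bdd2(1) _ superexp_add[OF r] \<eta> X0a])
    show "(\<lambda>x. u x + v x) integrable_on {l..r}" if "0 \<le> l" for l r
      by (intro integrable_add intu intv that)
    fix x y assume xy: "X0 \<le> x" "x \<le> y"
    have add: "integral {l..r} (\<lambda>x. u x + v x) = integral {l..r} u + integral {l..r} v" if "0 \<le> l" for l r
      by (rule integral_add[OF intu intv]) (use that in auto)
    have "(z - a) * (u z + v z) - (r1 z + r2 z) = integral {0..z - a} u + integral {a - h..z - h} v
        + integral {a - h..z - a} v + integral {0..z - h} u" if "X0 \<le> z" for z
      using equ[OF that] eqv[OF that] by (simp add: distrib_left)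
    note eqs = this[of x] this[of y]
    have "integral {0..y - a} u = integral {0..x - a} u + integral {x - a..y - a} u"
      "integral {0..y - h} u = integral {0..x - h} u + integral {x - h..y - h} u"
      "integral {a - h..y - a} v = integral {a - h..x - a} v + integral {x - a..y - a} v"
      "integral {a - h..y - h} v = integral {a - h..x - h} v + integral {x - h..y - h} v"
      using xy X0 h_le_a h_pos by (auto intro!: split intu intv)
    moreover have "integral {x - a..y - a} (\<lambda>x. u x + v x) = integral {x - a..y - a} u
        + integral {x - a..y - a} v"
      "integral {x - h..y - h} (\<lambda>x. u x + v x) = integral {x - h..y - h} u + integral {x - h..y - h} v"
      using xy X0a h_le_a by (auto intro!: add)
    ultimately show "(y - a) * (u y + v y) - (r1 y + r2 y) - ((x - a) * (u x + v x) - (r1 x + r2 x)) =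
      integral {x - a..y - a} (\<lambda>x. u x + v x) + integral {x - h..y - h} (\<lambda>x. u x + v x)"
      using eqs xy by linarith
  qed
  then obtain \<alpha> where s: "superexp \<eta> (\<lambda>x. (u x + v x) - \<alpha> * (x + h))" by blast
  have d: "superexp \<eta> (\<lambda>x. u x - v x)"
  proof (rule delay_decay[OF bdd2(2) _ superexp_diff[OF r] \<eta> X0a])
    show "(\<lambda>x. u x - v x) integrable_on {l..r}" if "0 \<le> l" for l r
      by (intro integrable_diff intu intv that)
    fix x assume x: "X0 \<le> x"
    have "integral {x - a..x - h} (\<lambda>x. u x - v x) = integral {x - a..x - h} u - integral {x - a..x - h} v"
      by (rule integral_diff[OF intu intv]) (use x X0a in auto)
    moreover have "integral {0..x - h} u = integral {0..x - a} u + integral {x - a..x - h} u"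
      "integral {a - h..x - h} v = integral {a - h..x - a} v + integral {x - a..x - h} v"
      using x X0 h_le_a h_pos by (auto intro!: split intu intv)
    moreover have "(x - a) * (u x - v x) = (x - a) * u x - (x - a) * v x"
      by (rule right_diff_distrib)
    ultimately show "(x - a) * (u x - v x) = r1 x - r2 x - integral {x - a..x - h} (\<lambda>x. u x - v x)"
      using equ[OF x] eqv[OF x] by linarith
  qed
  show ?thesis
  proof (intro exI[of _ "\<alpha> / 2"] conjI)
    have "superexp \<eta> (\<lambda>x. 1 / 2 * (((u x + v x) - \<alpha> * (x + h)) + (u x - v x)))"
      by (rule superexp_cmult[OF superexp_add[OF s d]])
    then show "superexp \<eta> (\<lambda>x. u x - \<alpha> / 2 * (x + h))"
      by (simp add: algebra_simps add_divide_distrib diff_divide_distrib)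
    have "superexp \<eta> (\<lambda>x. 1 / 2 * (((u x + v x) - \<alpha> * (x + h)) - (u x - v x)))"
      by (rule superexp_cmult[OF superexp_diff[OF s d]])
    then show "superexp \<eta> (\<lambda>x. v x - \<alpha> / 2 * (x + h))"
      by (simp add: algebra_simps add_divide_distrib diff_divide_distrib)
  qed
qed

text \<open>
  Convolutions of superexponentially small functions, with total shift \<open>h\<close>. The factor \<open>5\<close> is not
  optimal: estimating at \<open>n + 1\<close> rather than \<open>n\<close> doubles \<open>2 * \<eta>\<close> but gains the factor \<open>rate 1 x\<close>, which absorbs
  the length of the interval of integration, and another \<open>\<eta>\<close> absorbs the effect of the shift.
\<close>

lemma superexp_convolution:
  assumes e: "superexp \<eta> e" "superexp \<eta> e'" and \<eta>: "0 < \<eta>"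
    and w: "\<And>x. 0 \<le> x \<Longrightarrow> w x \<le> x"
    and f: "\<And>x \<tau>. 0 \<le> x \<Longrightarrow> 0 \<le> \<tau> \<Longrightarrow> \<tau> \<le> w x \<Longrightarrow>
      \<exists>p p'. 0 \<le> p \<and> 0 \<le> p' \<and> p + p' = x - h \<and> \<bar>f x \<tau>\<bar> \<le> \<bar>e p\<bar> * \<bar>e' p'\<bar>"
  shows "superexp (5 * \<eta>) (\<lambda>x. integral {0..w x} (f x))"
proof -
  obtain C C' where C: "C \<ge> 0" "\<And>n x. x \<ge> 0 \<Longrightarrow> \<bar>e x\<bar> \<le> C * exp (\<eta> * 2 ^ n) * rate n x"
    and C': "C' \<ge> 0" "\<And>n x. x \<ge> 0 \<Longrightarrow> \<bar>e' x\<bar> \<le> C' * exp (\<eta> * 2 ^ n) * rate n x"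
    using e unfolding superexp_def by blast
  define D where "D = C * C' * (2 / \<eta>) * (3 * a)"
  have D0: "0 \<le> D" using C C' \<eta> a_pos by (simp add: D_def)
  show ?thesis
    unfolding superexp_def
  proof (intro exI[of _ D] conjI allI impI D0)
    fix n :: nat and x :: real assume x: "0 \<le> x"
    let ?R = "D * exp (5 * \<eta> * 2 ^ n) * rate n x"
    show "\<bar>integral {0..w x} (f x)\<bar> \<le> ?R"
    proof (cases "f x integrable_on {0..w x} \<and> 0 \<le> w x")
      case False
      then have "integral {0..w x} (f x) = 0"
        by (cases "0 \<le> w x") (auto simp: not_integrable_integral)
      then show ?thesis using D0 by simp
    next
      case True
      let ?N = "Suc n"
      let ?B = "C * C' * exp (4 * \<eta> * 2 ^ n) * (2 ^ ?N * rate ?N x)"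
      have "\<bar>f x \<tau>\<bar> \<le> ?B" if \<tau>: "0 \<le> \<tau>" "\<tau> \<le> w x" for \<tau>
      proof -
        obtain p p' where p: "0 \<le> p" "0 \<le> p'" "p + p' = x - h" "\<bar>f x \<tau>\<bar> \<le> \<bar>e p\<bar> * \<bar>e' p'\<bar>"
          using f[OF x \<tau>] by blast
        have "\<bar>e p\<bar> * \<bar>e' p'\<bar> \<le> (C * exp (\<eta> * 2 ^ ?N) * rate ?N p) * (C' * exp (\<eta> * 2 ^ ?N) * rate ?N p')"
          by (intro mult_mono C(2)[of p ?N] C'(2)[of p' ?N] p) (use C C' in auto)
        also have "\<dots> = C * C' * (exp (\<eta> * 2 ^ ?N) * exp (\<eta> * 2 ^ ?N)) * (rate ?N p * rate ?N p')"
          by (simp only: mult_ac)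
        also have "exp (\<eta> * 2 ^ ?N) * exp (\<eta> * 2 ^ ?N) = exp (4 * \<eta> * 2 ^ n)"
          by (simp add: exp_add[symmetric])
        also have "rate ?N p * rate ?N p' = rate ?N (x - h)"
          by (simp only: rate_add[symmetric] p(3))
        also have "C * C' * exp (4 * \<eta> * 2 ^ n) * rate ?N (x - h) \<le> ?B"
          unfolding rate_shift[symmetric] using h_le_a C C' by (intro mult_left_mono rate_antimono) auto
        finally show ?thesis using p(4) by linarith
      qed
      then have "\<bar>integral {0..w x} (f x)\<bar> \<le> ?B * (w x - 0)"
        using True by (intro abs_integral_le_const) auto
      also have "\<dots> \<le> ?B * (x + h)"
        using w[OF x] h_pos C C' by (intro mult_left_mono) auto
      also have "\<dots> = C * C' * exp (4 * \<eta> * 2 ^ n) * (2 * 2 ^ n) * ((x + h) * rate 1 x) * rate n x"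
        using rate_Suc[of n x] by (simp add: mult_ac)
      also have "\<dots> \<le> C * C' * exp (4 * \<eta> * 2 ^ n) * (2 / \<eta> * exp (\<eta> * 2 ^ n)) * (3 * a) * rate n x"
      proof -
        have "\<eta> * 2 ^ n \<le> exp (\<eta> * 2 ^ n)"
          using exp_ge_add_one_self[of "\<eta> * 2 ^ n"] by linarith
        then have "2 * 2 ^ n \<le> 2 / \<eta> * exp (\<eta> * 2 ^ n)"
          using \<eta> by (simp add: field_simps)
        then have "C * C' * exp (4 * \<eta> * 2 ^ n) * (2 * 2 ^ n)
            \<le> C * C' * exp (4 * \<eta> * 2 ^ n) * (2 / \<eta> * exp (\<eta> * 2 ^ n))"
          using C C' by (intro mult_left_mono) auto
        from mult_mono[OF this linear_rate_le[OF x]] show ?thesis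
          using C C' \<eta> h_pos x by (intro mult_right_mono) auto
      qed
      also have "\<dots> = D * (exp (4 * \<eta> * 2 ^ n) * exp (\<eta> * 2 ^ n)) * rate n x"
        by (simp add: D_def mult_ac)
      also have "exp (4 * \<eta> * 2 ^ n) * exp (\<eta> * 2 ^ n) = exp (5 * \<eta> * 2 ^ n)"
        by (simp add: exp_add[symmetric])
      finally show ?thesis .
    qed
  qed
qed

lemma superexp_powr_bound:
  assumes E: "superexp \<eta> E" and \<eta>: "\<eta> \<le> 1" and c: "0 \<le> c"
  shows "\<exists>C\<ge>0. \<forall>x\<ge>a. \<bar>E x\<bar> \<le> C * (4 * exp 1 / (x / a)) powr (x / a - c)"
proof -
  obtain C where C: "C \<ge> 0" "\<And>n x. x \<ge> 0 \<Longrightarrow> \<bar>E x\<bar> \<le> C * exp (\<eta> * 2 ^ n) * rate n x"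
    using E unfolding superexp_def by blast
  define D where "D = C + C * exp \<eta> * (4 * exp 1) powr c"
  have D: "0 \<le> D" "C \<le> D" "C * exp \<eta> * (4 * exp 1) powr c \<le> D"
    using C by (auto simp: D_def)
  have "\<bar>E x\<bar> \<le> D * (4 * exp 1 / (x / a)) powr (x / a - c)" if x: "a \<le> x" for x
  proof -
    define k where "k = x / a"
    have k1: "1 \<le> k" using x a_pos by (simp add: k_def)
    have x0: "0 \<le> x" using x a_pos by simp
    have "\<bar>E x\<bar> \<le> D * (4 * exp 1 / k) powr (k - c)"
    proof (cases "4 * exp 1 \<le> k")
      case True
      \<comment> \<open>the nearly optimal choice: \<open>2 ^ n \<le> k < 2 * 2 ^ n\<close>\<close>
      define n where "n = nat \<lfloor>log 2 k\<rfloor>"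
      have l0: "0 \<le> log 2 k" using k1 by simp
      have n: "real n \<le> log 2 k" "log 2 k \<le> real n + 1"
        unfolding n_def using l0 by linarith+
      have le: "2 ^ n \<le> k"
        using n(1) k1 by (simp add: powr_realpow[symmetric] le_log_iff)
      have ge: "k \<le> 2 * 2 ^ n"
      proof -
        have "k \<le> 2 powr (real n + 1)" using n(2) k1 by (simp add: log_le_iff)
        then show ?thesis by (simp add: powr_add powr_realpow)
      qed
      have "exp (\<eta> * 2 ^ n) \<le> exp k"
        using order_trans[OF mult_right_mono[OF \<eta>, of "2 ^ n"], of k] le by simp
      moreover have "rate n x \<le> (2 / k) powr k"
      proof -
        have "rate n x = (2 powr - real n) powr k"
          by (simp add: rate_def powr_powr k_def)
        also have "2 powr - real n = 1 / 2 ^ n"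
          by (simp add: powr_minus powr_realpow divide_inverse)
        also have "(1 / 2 ^ n) powr k \<le> (2 / k) powr k"
          using ge k1 by (intro powr_mono2) (auto simp: field_simps)
        finally show ?thesis .
      qed
      ultimately have "exp (\<eta> * 2 ^ n) * rate n x \<le> exp k * (2 / k) powr k"
        by (intro mult_mono) auto
      also have "\<dots> = (2 * exp 1 / k) powr k"
      proof -
        have "exp k = exp 1 powr k" by (simp add: powr_def)
        then show ?thesis using k1 by (simp add: powr_mult[symmetric] mult.commute)
      qed
      also have "\<dots> \<le> (4 * exp 1 / k) powr k"
        using k1 by (intro powr_mono2 divide_right_mono) auto
      also have "\<dots> \<le> (4 * exp 1 / k) powr (k - c)"
        using True k1 c by (intro powr_mono') auto
      finally have "C * (exp (\<eta> * 2 ^ n) * rate n x) \<le> D * (4 * exp 1 / k) powr (k - c)"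
        using C D by (intro mult_mono) auto
      then show ?thesis using C(2)[OF x0, of n] by (simp add: mult.assoc)
    next
      case False
      have "(4 * exp 1) powr - c \<le> (4 * exp 1 / k) powr - c"
        using k1 c by (intro powr_mono2') (auto simp: divide_le_eq mult_le_cancel_left1)
      also have "\<dots> \<le> (4 * exp 1 / k) powr (k - c)"
        using False k1 by (intro powr_mono) auto
      finally have "C * exp \<eta> * (4 * exp 1) powr c * (4 * exp 1) powr - c \<le> D * (4 * exp 1 / k) powr (k - c)"
        using D by (intro mult_mono) auto
      then have "C * exp \<eta> \<le> D * (4 * exp 1 / k) powr (k - c)"
        by (simp add: mult.assoc powr_add[symmetric])
      then show ?thesis using C(2)[OF x0, of 0] by simp
    qed
    then show ?thesis by (simp add: k_def)
  qed
  then show ?thesis using D by blast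
qed

end

section \<open>The law of the number of particles\<close>

abbreviation nat_measure :: "nat measure" where
  "nat_measure \<equiv> count_space UNIV"

text \<open>
  The uniform distribution on \<open>(0, L)\<close> as a probability kernel in \<open>L\<close>. The value at \<open>L \<le> 0\<close> is arbitrary.
\<close>

lemma measurable_uniform_interval:
  "(\<lambda>L :: real. uniform_measure lborel {0<..<(if 0 < L then L else 1)}) \<in> borel \<rightarrow>\<^sub>M prob_algebra borel"
proof (rule measurable_prob_algebraI)
  fix L :: real
  show "prob_space (uniform_measure lborel {0<..<(if 0 < L then L else 1)})"
    by (rule prob_space_uniform_measure) auto
next
  show "(\<lambda>L :: real. uniform_measure lborel {0<..<(if 0 < L then L else 1)})
      \<in> borel \<rightarrow>\<^sub>M subprob_algebra borel"
  proof (rule measurable_subprob_algebra)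
    fix L :: real
    show "subprob_space (uniform_measure lborel {0<..<(if 0 < L then L else 1)})"
      by (intro prob_space_imp_subprob_space prob_space_uniform_measure) auto
    show "sets (uniform_measure lborel {0<..<(if 0 < L then L else 1)}) = sets borel"
      by simp
  next
    fix A :: "real set" assume [measurable]: "A \<in> sets borel"
    have "emeasure (uniform_measure lborel {0<..<(if 0 < L then L else 1)}) A
       = (\<integral>\<^sup>+ y. indicator A y * indicator {y. 0 < y \<and> y < (if 0 < L then L else 1)} y \<partial>lborel)
          / ennreal (if 0 < L then L else 1)" for L :: real
    proof -
      have "emeasure lborel ({0<..<(if 0 < L then L else 1)} \<inter> A)
        = (\<integral>\<^sup>+ y. indicator ({0<..<(if 0 < L then L else 1)} \<inter> A) y \<partial>lborel)"
        by simp
      also have "\<dots> = (\<integral>\<^sup>+ y. indicator A y * indicator {y. 0 < y \<and> y < (if 0 < L then L else 1)} y \<partial>lborel)"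
        by (intro nn_integral_cong) (auto simp: indicator_def)
      finally show ?thesis
        by (subst emeasure_uniform_measure) auto
    qed
    then show "(\<lambda>L :: real. emeasure (uniform_measure lborel {0<..<(if 0 < L then L else 1)}) A)
        \<in> borel_measurable borel"
      by simp
  qed
qed

context trapezium
begin

text \<open>
  The area \<open>h\<close> of a particle, and the horizontal extent \<open>d\<close> of each of its legs; \<open>d = a - h\<close>.
\<close>

abbreviation h :: real where "h \<equiv> (a + b) / 2"
abbreviation d :: real where "d \<equiv> (a - b) / 2"

text \<open>
  The law of \<open>1 + m + n\<close> for independent \<open>m\<close> and \<open>n\<close>.
\<close>

definition convolve :: "nat measure \<Rightarrow> nat measure \<Rightarrow> nat measure" where
  "convolve M N = do { m \<leftarrow> M; n \<leftarrow> N; return nat_measure (1 + m + n) }"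

lemma measurable_convolve [measurable (raw)]:
  assumes "f \<in> M \<rightarrow>\<^sub>M prob_algebra nat_measure" "g \<in> M \<rightarrow>\<^sub>M prob_algebra nat_measure"
  shows "(\<lambda>x. convolve (f x) (g x)) \<in> M \<rightarrow>\<^sub>M prob_algebra nat_measure"
proof -
  note [measurable] = assms
  show ?thesis
    unfolding convolve_def by measurable
qed

lemma remaining_place_Para:
  "remaining (Para x) (place (Para x) \<tau>) =
    (if \<tau> < x - a then (Para \<tau>, Trap (x - \<tau> - h)) else (Trap (\<tau> + d - (x - a)), Para (2 * x - 2 * a - \<tau>)))"
  by (auto simp: Let_def field_simps)

lemma remaining_place_Trap:
  "remaining (Trap x) (place (Trap x) \<tau>) =
    (if x < a + d then (Para \<tau>, Para (x - \<tau> - h))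
     else if \<tau> < x - a - d then (Trap (\<tau> + d), Trap (x - a - \<tau>))
     else (Para (\<tau> - (x - a - d)), Para (2 * x - 2 * a - \<tau>)))"
  by (auto simp: Let_def field_simps)

lemma placement_length_pos:
  assumes "critical_area s < area s"
  shows "0 < placement_length s"
  using assms b_nonneg b_le_a by (cases s) (auto simp: field_simps)

lemma num_particles_step:
  assumes "critical_area s < area s"
  shows "num_particles s = uniform_measure lborel {0<..<placement_length s} \<bind> (\<lambda>\<tau>.
      if 0 < \<tau> \<and> \<tau> < placement_length s then
        convolve (num_particles (fst (remaining s (place s \<tau>)))) (num_particles (snd (remaining s (place s \<tau>))))
      else return nat_measure 0)"
  using assms by (subst num_particles.simps) (simp add: convolve_def case_prod_beta cong: if_cong)

text \<open>
  The law on one strip refers to the laws on a continuum of smaller strips, which have to be known to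
  depend measurably on the area. Hence measurable kernels that agree with the law on all strips of area at
  most \<open>N * h\<close> are constructed by induction on \<open>N\<close>; a deposition reduces the area by at least \<open>h\<close>.
\<close>

lemma num_particles_measurable_upto:
  "\<exists>\<kappa>P \<kappa>T. \<kappa>P \<in> borel \<rightarrow>\<^sub>M prob_algebra nat_measure \<and> \<kappa>T \<in> borel \<rightarrow>\<^sub>M prob_algebra nat_measure \<and>
     (\<forall>x \<le> real N * h. \<kappa>P x = num_particles (Para x) \<and> \<kappa>T x = num_particles (Trap x))"
proof (induction N)
  case 0
  have "num_particles (Para x) = return nat_measure 0" "num_particles (Trap x) = return nat_measure 0"
    if "x \<le> 0" for x
    using that a_pos b_nonneg by (subst num_particles.simps; simp)+
  then show ?case
    by (intro exI[of _ "\<lambda>_. return nat_measure 0"]) auto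
next
  case (Suc N)
  then obtain \<kappa>P \<kappa>T where
    [measurable]: "\<kappa>P \<in> borel \<rightarrow>\<^sub>M prob_algebra nat_measure" "\<kappa>T \<in> borel \<rightarrow>\<^sub>M prob_algebra nat_measure"
    and eq: "\<And>x. x \<le> real N * h \<Longrightarrow> \<kappa>P x = num_particles (Para x) \<and> \<kappa>T x = num_particles (Trap x)"
    by blast
  define U where "U = (\<lambda>L :: real. uniform_measure lborel {0<..<(if 0 < L then L else 1)})"
  have [measurable]: "U \<in> borel \<rightarrow>\<^sub>M prob_algebra borel"
    unfolding U_def by (rule measurable_uniform_interval)
  define stop where "stop = (\<lambda>(c :: real) x (M :: nat measure). if x < c then return nat_measure 0
    else if x = c then return nat_measure 1 else M)"
  define kP where "kP = (\<lambda>x. stop a x (U (2 * x - 2 * a) \<bind> (\<lambda>\<tau>.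
     if 0 < \<tau> \<and> \<tau> < 2 * x - 2 * a then
       if \<tau> < x - a then convolve (\<kappa>P \<tau>) (\<kappa>T (x - \<tau> - h))
       else convolve (\<kappa>T (\<tau> + d - (x - a))) (\<kappa>P (2 * x - 2 * a - \<tau>))
     else return nat_measure 0)))"
  define LT where "LT = (\<lambda>x. if x < (3 * a - b) / 2 then x - (a + b) / 2 else 2 * x - 2 * a)"
  define kT where "kT = (\<lambda>x. stop h x (U (LT x) \<bind> (\<lambda>\<tau>.
     if 0 < \<tau> \<and> \<tau> < LT x then
       if x < a + d then convolve (\<kappa>P \<tau>) (\<kappa>P (x - \<tau> - h))
       else if \<tau> < x - a - d then convolve (\<kappa>T (\<tau> + d)) (\<kappa>T (x - a - \<tau>))
       else convolve (\<kappa>P (\<tau> - (x - a - d))) (\<kappa>P (2 * x - 2 * a - \<tau>))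
     else return nat_measure 0)))"
  have [measurable]: "LT \<in> borel_measurable borel"
    unfolding LT_def by measurable
  have *: "convolve (\<kappa> l) (\<kappa>' r) = convolve (num_particles (s l)) (num_particles (s' r))"
    if "\<kappa> = \<kappa>P \<and> s = Para \<or> \<kappa> = \<kappa>T \<and> s = Trap" "\<kappa>' = \<kappa>P \<and> s' = Para \<or> \<kappa>' = \<kappa>T \<and> s' = Trap"
      "l \<le> real N * h" "r \<le> real N * h" for \<kappa> \<kappa>' s s' l r
    using eq[of l] eq[of r] that by auto
  have "kP \<in> borel \<rightarrow>\<^sub>M prob_algebra nat_measure"
    unfolding kP_def stop_def by measurable
  moreover have "kT \<in> borel \<rightarrow>\<^sub>M prob_algebra nat_measure"
    unfolding kT_def stop_def by measurable
  moreover have "kP x = num_particles (Para x)" if x: "x \<le> real (Suc N) * h" for x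
  proof (cases "x > a")
    case True
    have "kP x = num_particles (Para x)"
      unfolding num_particles_step[of "Para x", simplified, OF True] kP_def stop_def U_def remaining_place_Para
      using True x b_le_a
      by (auto intro!: bind_cong * simp: field_simps)
    then show ?thesis .
  next
    case False
    then show ?thesis
      by (subst num_particles.simps) (simp add: kP_def stop_def)
  qed
  moreover have "kT x = num_particles (Trap x)" if x: "x \<le> real (Suc N) * h" for x
  proof (cases "x > h")
    case True
    have p: "LT x > 0"
      using placement_length_pos[of "Trap x"] True by (auto simp: LT_def)
    have pl: "placement_length (Trap x) = LT x"
      by (simp add: LT_def)
    have tr: "critical_area (Trap x) < area (Trap x)"
      using True by simp
    show ?thesis
      using p True x b_le_a
      unfolding num_particles_step[OF tr] kT_def stop_def U_def remaining_place_Trap pl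
      by (auto intro!: bind_cong * simp: LT_def field_simps)
  next
    case False
    then show ?thesis
      by (subst num_particles.simps) (simp add: kT_def stop_def)
  qed
  ultimately show ?case by blast
qed

lemma measurable_num_particles [measurable]:
  "(\<lambda>x. num_particles (Para x)) \<in> borel \<rightarrow>\<^sub>M prob_algebra nat_measure"
  "(\<lambda>x. num_particles (Trap x)) \<in> borel \<rightarrow>\<^sub>M prob_algebra nat_measure"
proof -
  obtain \<kappa>P \<kappa>T where
    [measurable]: "\<And>N. \<kappa>P N \<in> borel \<rightarrow>\<^sub>M prob_algebra nat_measure"
      "\<And>N. \<kappa>T N \<in> borel \<rightarrow>\<^sub>M prob_algebra nat_measure"
    and eq: "\<And>N x. x \<le> real N * h \<Longrightarrow> \<kappa>P N x = num_particles (Para x) \<and> \<kappa>T N x = num_particles (Trap x)"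
    using num_particles_measurable_upto by metis
  have h: "h > 0" using a_pos b_nonneg by simp
  have "x \<le> real (nat \<lceil>x / h\<rceil>) * h" for x
  proof -
    have "x / h \<le> real (nat \<lceil>x / h\<rceil>)" by linarith
    then show ?thesis using h by (simp add: divide_le_eq)
  qed
  then have "num_particles (Para x) = \<kappa>P (nat \<lceil>x / h\<rceil>) x" "num_particles (Trap x) = \<kappa>T (nat \<lceil>x / h\<rceil>) x" for x
    using eq by auto
  then show "(\<lambda>x. num_particles (Para x)) \<in> borel \<rightarrow>\<^sub>M prob_algebra nat_measure"
    "(\<lambda>x. num_particles (Trap x)) \<in> borel \<rightarrow>\<^sub>M prob_algebra nat_measure"
    by (simp_all add: measurable_compose_countable)
qed

abbreviation left_strip :: "strip \<Rightarrow> real \<Rightarrow> strip" where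
  "left_strip s \<tau> \<equiv> fst (remaining s (place s \<tau>))"

abbreviation right_strip :: "strip \<Rightarrow> real \<Rightarrow> strip" where
  "right_strip s \<tau> \<equiv> snd (remaining s (place s \<tau>))"

lemma measurable_remaining:
  assumes [measurable]: "(\<lambda>x. A (Para x)) \<in> borel \<rightarrow>\<^sub>M M" "(\<lambda>x. A (Trap x)) \<in> borel \<rightarrow>\<^sub>M M"
  shows "(\<lambda>\<tau>. A (left_strip s \<tau>)) \<in> borel \<rightarrow>\<^sub>M M" "(\<lambda>\<tau>. A (right_strip s \<tau>)) \<in> borel \<rightarrow>\<^sub>M M"
proof -
  have "(\<lambda>\<tau>. A (left_strip s \<tau>)) \<in> borel \<rightarrow>\<^sub>M M \<and> (\<lambda>\<tau>. A (right_strip s \<tau>)) \<in> borel \<rightarrow>\<^sub>M M"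
    by (cases s; simp only: remaining_place_Para remaining_place_Trap if_distrib[of fst] if_distrib[of snd]
        if_distrib[of A] fst_conv snd_conv; intro conjI; measurable)
  then show "(\<lambda>\<tau>. A (left_strip s \<tau>)) \<in> borel \<rightarrow>\<^sub>M M" "(\<lambda>\<tau>. A (right_strip s \<tau>)) \<in> borel \<rightarrow>\<^sub>M M"
    by auto
qed

lemma num_particles_in_prob_algebra: "num_particles s \<in> space (prob_algebra nat_measure)"
  using measurable_space[OF measurable_num_particles(1)] measurable_space[OF measurable_num_particles(2)]
  by (cases s) auto

lemma prob_space_num_particles: "prob_space (num_particles s)"
  and sets_num_particles [measurable_cong]: "sets (num_particles s) = sets nat_measure"
  using num_particles_in_prob_algebra[of s] by (auto simp: space_prob_algebra)

lemma space_num_particles [simp]: "space (num_particles s) = UNIV"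
  using sets_eq_imp_space_eq[OF sets_num_particles[of s]] by simp

lemma measurable_num_particles_source [simp]: "(f :: nat \<Rightarrow> _) \<in> num_particles s \<rightarrow>\<^sub>M M \<longleftrightarrow> range f \<subseteq> space M"
  by (subst measurable_cong_sets[OF sets_num_particles refl]) auto

lemma measurable_split_kernel:
  "(\<lambda>\<tau>. if 0 < \<tau> \<and> \<tau> < L then
        convolve (num_particles (left_strip s \<tau>)) (num_particles (right_strip s \<tau>))
      else return nat_measure 0) \<in> borel \<rightarrow>\<^sub>M prob_algebra nat_measure"
proof -
  note [measurable] = measurable_remaining[of num_particles, OF measurable_num_particles]
  show ?thesis by measurable
qed

lemma nn_integral_convolve:
  "(\<integral>\<^sup>+k. f k \<partial>convolve (num_particles l) (num_particles r)) =
    (\<integral>\<^sup>+m. \<integral>\<^sup>+n. f (1 + m + n) \<partial>num_particles r \<partial>num_particles l)"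
proof -
  have ret: "(\<lambda>n. return nat_measure (1 + m + n)) \<in> num_particles r \<rightarrow>\<^sub>M subprob_algebra nat_measure" for m
    by (auto simp: space_subprob_algebra intro!: prob_space_imp_subprob_space prob_space_return)
  have k: "(\<lambda>m. num_particles r \<bind> (\<lambda>n. return nat_measure (1 + m + n)))
      \<in> num_particles l \<rightarrow>\<^sub>M subprob_algebra nat_measure"
    using subprob_space_bind[OF prob_space_imp_subprob_space[OF prob_space_num_particles] ret]
      sets_bind_measurable[OF ret]
    by (auto simp: space_subprob_algebra)
  show ?thesis
    unfolding convolve_def
    by (subst nn_integral_bind[OF _ k], simp, subst nn_integral_bind[OF _ ret], simp)
       (simp add: nn_integral_return)
qed

lemma nn_integral_num_particles:
  assumes "critical_area s < area s"
  shows "(\<integral>\<^sup>+k. f k \<partial>num_particles s) =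
    (\<integral>\<^sup>+\<tau>. (\<integral>\<^sup>+m. \<integral>\<^sup>+n. f (1 + m + n) \<partial>num_particles (right_strip s \<tau>) \<partial>num_particles (left_strip s \<tau>))
        * indicator {0<..<placement_length s} \<tau> \<partial>lborel) / ennreal (placement_length s)"
proof -
  let ?L = "placement_length s"
  define K where "K = (\<lambda>\<tau>. if 0 < \<tau> \<and> \<tau> < ?L then
        convolve (num_particles (left_strip s \<tau>)) (num_particles (right_strip s \<tau>))
      else return nat_measure 0)"
  have K [measurable]: "K \<in> borel \<rightarrow>\<^sub>M subprob_algebra nat_measure"
    unfolding K_def by (rule measurable_prob_algebraD[OF measurable_split_kernel])
  have L: "0 < ?L" by (rule placement_length_pos[OF assms])
  have "(\<integral>\<^sup>+k. f k \<partial>num_particles s) = (\<integral>\<^sup>+\<tau>. (\<integral>\<^sup>+k. f k \<partial>K \<tau>) \<partial>uniform_measure lborel {0<..<?L})"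
    unfolding num_particles_step[OF assms] K_def[symmetric]
    by (rule nn_integral_bind[where B = nat_measure])
       (simp_all add: K measurable_cong_sets[OF sets_uniform_measure refl])
  also have "\<dots> = (\<integral>\<^sup>+\<tau>. (\<integral>\<^sup>+k. f k \<partial>K \<tau>) * indicator {0<..<?L} \<tau> \<partial>lborel) / ennreal ?L"
    using L by (subst nn_integral_uniform_measure)
       (auto intro!: measurable_compose[OF K] nn_integral_measurable_subprob_algebra)
  also have "(\<integral>\<^sup>+\<tau>. (\<integral>\<^sup>+k. f k \<partial>K \<tau>) * indicator {0<..<?L} \<tau> \<partial>lborel) =
    (\<integral>\<^sup>+\<tau>. (\<integral>\<^sup>+m. \<integral>\<^sup>+n. f (1 + m + n) \<partial>num_particles (right_strip s \<tau>) \<partial>num_particles (left_strip s \<tau>))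
        * indicator {0<..<?L} \<tau> \<partial>lborel)"
    by (intro nn_integral_cong) (auto simp: indicator_def K_def nn_integral_convolve)
  finally show ?thesis .
qed

lemma remaining_area_sum:
  assumes "0 < \<tau>" "\<tau> < placement_length s"
  shows "area (left_strip s \<tau>) + area (right_strip s \<tau>) = area s - h"
    and "0 \<le> area (left_strip s \<tau>)" "0 \<le> area (right_strip s \<tau>)"
proof -
  have "area (left_strip s \<tau>) + area (right_strip s \<tau>) = area s - h \<and> 0 \<le> area (left_strip s \<tau>)
    \<and> 0 \<le> area (right_strip s \<tau>)"
    using assms b_nonneg b_le_a a_pos
    by (cases s) (auto simp: remaining_place_Para remaining_place_Trap field_simps
        simp del: remaining.simps place.simps split: if_splits)
  then show "area (left_strip s \<tau>) + area (right_strip s \<tau>) = area s - h"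
    "0 \<le> area (left_strip s \<tau>)" "0 \<le> area (right_strip s \<tau>)"
    by auto
qed

text \<open>
  The total area of the particles is at most that of the strip. In particular, every function of the
  number of particles is integrable.
\<close>

lemma num_particles_le: "AE k in num_particles s. real k * h \<le> max 0 (area s)"
proof (induction s rule: measure_induct_rule[where f = "\<lambda>s. nat \<lceil>area s / h\<rceil>"])
  case (less s)
  have h: "0 < h" using a_pos b_nonneg by simp
  consider "area s < critical_area s" | "area s = critical_area s" | "critical_area s < area s"
    by linarith
  then show ?case
  proof cases
    case 1
    then have eq: "num_particles s = return nat_measure 0"
      by (subst num_particles.simps) auto
    show ?thesis
      by (subst eq) (simp add: AE_return)
  next
    case 2
    then have eq: "num_particles s = return nat_measure 1"
      by (subst num_particles.simps) auto
    have "h \<le> area s"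
      using 2 b_le_a by (cases s) auto
    then show ?thesis
      using h by (subst eq) (simp add: AE_return)
  next
    case 3
    let ?L = "placement_length s"
    have eq: "(\<integral>\<^sup>+k. indicator {k. \<not> real k * h \<le> max 0 (area s)} k \<partial>num_particles s) = 0"
    proof -
      have inner: "(\<integral>\<^sup>+m. \<integral>\<^sup>+n. indicator {k. \<not> real k * h \<le> max 0 (area s)} (1 + m + n)
          \<partial>num_particles (right_strip s \<tau>) \<partial>num_particles (left_strip s \<tau>)) = 0"
        if \<tau>: "0 < \<tau>" "\<tau> < ?L" for \<tau>
      proof -
        let ?l = "left_strip s \<tau>" and ?r = "right_strip s \<tau>"
        note A = remaining_area_sum[OF \<tau>]
        have IHl: "AE m in num_particles ?l. real m * h \<le> area ?l"
          using less[of ?l] rank_decreasing[of ?l s] A 3 by (simp add: max_def)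
        have IHr: "AE m in num_particles ?r. real m * h \<le> area ?r"
          using less[of ?r] rank_decreasing[of ?r s] A 3 by (simp add: max_def)
        have "AE n in num_particles ?r. indicator {k. \<not> real k * h \<le> max 0 (area s)} (1 + m + n)
            = (0 :: ennreal)"
          if m: "real m * h \<le> area ?l" for m
          using IHr
        proof eventually_elim
          case (elim n)
          have "real (1 + m + n) * h = h + real m * h + real n * h"
            by (simp only: of_nat_add of_nat_1 distrib_right mult_1)
          then have "real (1 + m + n) * h \<le> area s"
            using elim m A(1) by linarith
          then show ?case
            by (auto simp: indicator_def)
        qed
        then have "(\<integral>\<^sup>+n. indicator {k. \<not> real k * h \<le> max 0 (area s)} (1 + m + n) \<partial>num_particles ?r) = 0"
          if "real m * h \<le> area ?l" for m
          using that by (subst nn_integral_0_iff_AE) auto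
        then show ?thesis
          using IHl by (subst nn_integral_0_iff_AE) auto
      qed
      have "(\<integral>\<^sup>+\<tau>. (\<integral>\<^sup>+m. \<integral>\<^sup>+n. indicator {k. \<not> real k * h \<le> max 0 (area s)} (1 + m + n)
          \<partial>num_particles (right_strip s \<tau>) \<partial>num_particles (left_strip s \<tau>)) * indicator {0<..<?L} \<tau> \<partial>lborel)
          = (\<integral>\<^sup>+(\<tau> :: real). 0 \<partial>lborel)"
      proof (rule nn_integral_cong)
        fix \<tau>
        show "(\<integral>\<^sup>+m. \<integral>\<^sup>+n. indicator {k. \<not> real k * h \<le> max 0 (area s)} (1 + m + n)
          \<partial>num_particles (right_strip s \<tau>) \<partial>num_particles (left_strip s \<tau>)) * indicator {0<..<?L} \<tau>
              = (0 :: ennreal)"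
        proof (cases "0 < \<tau> \<and> \<tau> < ?L")
          case True
          then show ?thesis by (simp only: inner mult_zero_left)
        next
          case False
          then have "indicator {0<..<?L} \<tau> = (0 :: ennreal)" by (auto simp: indicator_def)
          then show ?thesis by (simp only: mult_zero_right)
        qed
      qed
      then show ?thesis
        by (subst nn_integral_num_particles[OF 3]) simp
    qed
    then have "AE k in num_particles s. indicator {k. \<not> real k * h \<le> max 0 (area s)} k = (0 :: ennreal)"
      by (subst (asm) nn_integral_0_iff_AE) auto
    then show ?thesis
      by eventually_elim (auto simp: indicator_def split: if_splits)
  qed
qed

lemma integrable_num_particles [simp]: "integrable (num_particles s) (f :: nat \<Rightarrow> real)"
proof -
  interpret prob_space "num_particles s" by (rule prob_space_num_particles)
  have h: "0 < h" using a_pos b_nonneg by simp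
  define N where "N = nat \<lceil>max 0 (area s) / h\<rceil>"
  show ?thesis
  proof (rule integrable_const_bound[where B = "\<Sum>k\<le>N. \<bar>f k\<bar>"])
    show "AE k in num_particles s. norm (f k) \<le> (\<Sum>k\<le>N. \<bar>f k\<bar>)"
      using num_particles_le[of s]
    proof eventually_elim
      case (elim k)
      then have "real k \<le> max 0 (area s) / h"
        using h by (simp add: field_simps)
      then have "k \<le> N"
        unfolding N_def by linarith
      then show ?case
        by (auto intro!: member_le_sum[of k "{..N}" "\<lambda>k. \<bar>f k\<bar>"])
    qed
  qed simp
qed

text \<open>
  The recursion for the expectation of a nonnegative function of the number of particles.
\<close>

lemma integral_num_particles:
  fixes f :: "nat \<Rightarrow> real"
  assumes s: "critical_area s < area s" and f: "\<And>k. 0 \<le> f k"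
    and G: "\<And>\<tau>. 0 < \<tau> \<Longrightarrow> \<tau> < placement_length s \<Longrightarrow> G \<tau> =
      (\<integral>m. \<integral>n. f (1 + m + n) \<partial>num_particles (right_strip s \<tau>) \<partial>num_particles (left_strip s \<tau>))"
    and [measurable]: "G \<in> borel_measurable borel"
    and K: "\<And>\<tau>. 0 < \<tau> \<Longrightarrow> \<tau> < placement_length s \<Longrightarrow> \<bar>G \<tau>\<bar> \<le> K"
  shows "placement_length s * (\<integral>k. f k \<partial>num_particles s) = integral {0..placement_length s} G"
proof -
  let ?L = "placement_length s"
  have L: "0 < ?L" by (rule placement_length_pos[OF s])
  have int: "set_integrable lborel {0<..<?L} G"
    using L by (intro set_integrable_bounded[where K = K]) (auto simp: K)
  have G0: "0 \<le> G \<tau>" if "0 < \<tau>" "\<tau> < ?L" for \<tau>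
    unfolding G[OF that] by (simp add: f)
  have "(\<integral>\<^sup>+m. \<integral>\<^sup>+n. ennreal (f (1 + m + n)) \<partial>num_particles (right_strip s \<tau>) \<partial>num_particles (left_strip s \<tau>))
     = ennreal (G \<tau>)" if "0 < \<tau>" "\<tau> < ?L" for \<tau>
    unfolding G[OF that] by (simp add: nn_integral_eq_integral f)
  then have "(\<integral>\<^sup>+\<tau>. (\<integral>\<^sup>+m. \<integral>\<^sup>+n. ennreal (f (1 + m + n))
          \<partial>num_particles (right_strip s \<tau>) \<partial>num_particles (left_strip s \<tau>))
        * indicator {0<..<?L} \<tau> \<partial>lborel) = (\<integral>\<^sup>+\<tau>. ennreal (indicator {0<..<?L} \<tau> *\<^sub>R G \<tau>) \<partial>lborel)"
    by (intro nn_integral_cong) (auto simp: indicator_def)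
  also have "\<dots> = ennreal (LINT \<tau>:{0<..<?L}|lborel. G \<tau>)"
    unfolding set_lebesgue_integral_def
    by (rule nn_integral_eq_integral[OF int[unfolded set_integrable_def]]) (auto simp: indicator_def G0)
  also have "(LINT \<tau>:{0<..<?L}|lborel. G \<tau>) = integral {0..?L} G"
    using set_borel_integral_eq_integral(2)[OF int] by (simp add: integral_open_interval_real)
  finally have "(\<integral>\<^sup>+k. ennreal (f k) \<partial>num_particles s) = ennreal (integral {0..?L} G) / ennreal ?L"
    by (subst nn_integral_num_particles[OF s]) simp
  moreover have "(\<integral>\<^sup>+k. ennreal (f k) \<partial>num_particles s) = ennreal (\<integral>k. f k \<partial>num_particles s)"
    by (simp add: nn_integral_eq_integral f)
  moreover have "0 \<le> integral {0<..<?L} G"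
    using set_borel_integral_eq_integral(1)[OF int] G0 by (intro integral_nonneg) auto
  then have "0 \<le> integral {0..?L} G"
    by (simp add: integral_open_interval_real)
  ultimately have "(\<integral>k. f k \<partial>num_particles s) = integral {0..?L} G / ?L"
    using L by (simp add: divide_ennreal f)
  then show ?thesis using L by simp
qed

section \<open>Integral equations for functionals of strips\<close>

text \<open>
  Functionals of strips that are measurable, and bounded on strips of bounded area.
\<close>

definition regular :: "(strip \<Rightarrow> real) \<Rightarrow> bool" where
  "regular A \<longleftrightarrow> (\<lambda>x. A (Para x)) \<in> borel_measurable borel \<and> (\<lambda>x. A (Trap x)) \<in> borel_measurable borel \<and>
    (\<forall>X. \<exists>K. \<forall>s. 0 \<le> area s \<and> area s \<le> X \<longrightarrow> \<bar>A s\<bar> \<le> K)"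

text \<open>
  The functional \<open>A\<close> of a strip is, up to the cross term \<open>2 * e l * e r\<close>, the mean over the uniform placement of
  the sum of its values on the two remaining strips \<open>l\<close> and \<open>r\<close>.
\<close>

definition splits :: "(strip \<Rightarrow> real) \<Rightarrow> (strip \<Rightarrow> real) \<Rightarrow> bool" where
  "splits A e \<longleftrightarrow> (\<forall>s. critical_area s < area s \<longrightarrow>
    placement_length s * A s = integral {0..placement_length s} (\<lambda>\<tau>.
      A (left_strip s \<tau>) + A (right_strip s \<tau>) + 2 * e (left_strip s \<tau>) * e (right_strip s \<tau>)))"

lemma regular_measurable:
  assumes "regular A"
  shows "(\<lambda>x. A (Para x)) \<in> borel_measurable borel" "(\<lambda>x. A (Trap x)) \<in> borel_measurable borel"
    "(\<lambda>\<tau>. A (left_strip s \<tau>)) \<in> borel_measurable borel" "(\<lambda>\<tau>. A (right_strip s \<tau>)) \<in> borel_measurable borel"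
  using assms measurable_remaining[of A borel] by (auto simp: regular_def)

lemma regular_bounded:
  assumes "regular A"
  obtains K where "0 \<le> K" "\<And>s. 0 \<le> area s \<Longrightarrow> area s \<le> X \<Longrightarrow> \<bar>A s\<bar> \<le> K"
proof -
  obtain K where K: "\<And>s. 0 \<le> area s \<Longrightarrow> area s \<le> X \<Longrightarrow> \<bar>A s\<bar> \<le> K"
    using assms unfolding regular_def by blast
  show ?thesis
    by (rule that[of "max 0 K"]) (use K in \<open>auto intro: max.coboundedI2\<close>)
qed

lemma regular_bdd:
  assumes "regular A"
  shows "\<exists>K. \<forall>x. 0 \<le> x \<and> x \<le> X \<longrightarrow> \<bar>A (Para x)\<bar> \<le> K" "\<exists>K. \<forall>x. 0 \<le> x \<and> x \<le> X \<longrightarrow> \<bar>A (Trap x)\<bar> \<le> K"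
  using regular_bounded[OF assms, of X] by (metis strip.sel)+

lemma regular_integrable:
  assumes "regular A" "0 \<le> l"
  shows "(\<lambda>x. A (Para x)) integrable_on {l..u}" "(\<lambda>x. A (Trap x)) integrable_on {l..u}"
proof -
  obtain K where K: "\<And>s. 0 \<le> area s \<Longrightarrow> area s \<le> u \<Longrightarrow> \<bar>A s\<bar> \<le> K"
    using regular_bounded[OF assms(1), of u] by blast
  show "(\<lambda>x. A (Para x)) integrable_on {l..u}" "(\<lambda>x. A (Trap x)) integrable_on {l..u}"
    by (rule integrable_on_bounded[OF regular_measurable(1)[OF assms(1)], of _ _ K]
             integrable_on_bounded[OF regular_measurable(2)[OF assms(1)], of _ _ K]; use assms(2) K in auto)+
qed

lemma regular_pair_integrable:
  fixes f g :: "real \<Rightarrow> real"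
  assumes A: "regular A" and e: "regular e"
    and f: "f \<in> borel_measurable borel" "g \<in> borel_measurable borel"
    and S: "S = Para \<or> S = Trap" and T: "T = Para \<or> T = Trap"
    and area: "\<And>\<tau>. l \<le> \<tau> \<Longrightarrow> \<tau> \<le> u \<Longrightarrow> 0 \<le> f \<tau> \<and> 0 \<le> g \<tau> \<and> f \<tau> \<le> X \<and> g \<tau> \<le> X"
  shows "(\<lambda>\<tau>. A (S (f \<tau>))) integrable_on {l..u}" "(\<lambda>\<tau>. A (T (g \<tau>))) integrable_on {l..u}"
    "(\<lambda>\<tau>. 2 * e (S (f \<tau>)) * e (T (g \<tau>))) integrable_on {l..u}"
proof -
  obtain K where K: "0 \<le> K" "\<And>s. 0 \<le> area s \<Longrightarrow> area s \<le> X \<Longrightarrow> \<bar>A s\<bar> \<le> K"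
    using regular_bounded[OF A, of X] by blast
  obtain L where L: "0 \<le> L" "\<And>s. 0 \<le> area s \<Longrightarrow> area s \<le> X \<Longrightarrow> \<bar>e s\<bar> \<le> L"
    using regular_bounded[OF e, of X] by blast
  have [simp]: "area (S y) = y" "area (T y) = y" for y
    using S T by auto
  have m: "(\<lambda>\<tau>. A (S (f \<tau>))) \<in> borel_measurable borel" "(\<lambda>\<tau>. A (T (g \<tau>))) \<in> borel_measurable borel"
    "(\<lambda>\<tau>. e (S (f \<tau>))) \<in> borel_measurable borel" "(\<lambda>\<tau>. e (T (g \<tau>))) \<in> borel_measurable borel"
    using S T measurable_compose[OF f(1)] measurable_compose[OF f(2)] regular_measurable(1,2)[OF A]
        regular_measurable(1,2)[OF e]
    by auto
  show "(\<lambda>\<tau>. A (S (f \<tau>))) integrable_on {l..u}"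
    by (rule integrable_on_bounded[OF m(1), of _ _ K]) (use area K in auto)
  show "(\<lambda>\<tau>. A (T (g \<tau>))) integrable_on {l..u}"
    by (rule integrable_on_bounded[OF m(2), of _ _ K]) (use area K in auto)
  show "(\<lambda>\<tau>. 2 * e (S (f \<tau>)) * e (T (g \<tau>))) integrable_on {l..u}"
  proof (rule integrable_on_bounded[where K = "2 * (L * L)"])
    show "(\<lambda>\<tau>. 2 * e (S (f \<tau>)) * e (T (g \<tau>))) \<in> borel_measurable borel"
      using m by (intro borel_measurable_times) auto
    fix \<tau> assume "l \<le> \<tau>" "\<tau> \<le> u"
    then have "\<bar>e (S (f \<tau>))\<bar> * \<bar>e (T (g \<tau>))\<bar> \<le> L * L"
      using area L by (intro mult_mono) auto
    then show "\<bar>2 * e (S (f \<tau>)) * e (T (g \<tau>))\<bar> \<le> 2 * (L * L)"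
      by (simp add: abs_mult)
  qed
qed

text \<open>
  Up and down placements contribute equally, by the symmetry \<open>\<tau> \<mapsto> 2 * x - 2 * a - \<tau>\<close>.
\<close>

lemma Para_equation:
  assumes A: "regular A" and e: "regular e" and sp: "splits A e" and x: "a < x"
  shows "(x - a) * A (Para x) = integral {0..x - a} (\<lambda>x. A (Para x)) + integral {a - h..x - h} (\<lambda>x. A (Trap x))
    + integral {0..x - a} (\<lambda>\<tau>. 2 * e (Para \<tau>) * e (Trap (x - h - \<tau>)))"
proof -
  define g where "g = (\<lambda>\<tau>. A (Para \<tau>) + A (Trap (x - h - \<tau>)) + 2 * e (Para \<tau>) * e (Trap (x - h - \<tau>)))"
  define G where "G = (\<lambda>\<tau>. A (left_strip (Para x) \<tau>) + A (right_strip (Para x) \<tau>)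
     + 2 * e (left_strip (Para x) \<tau>) * e (right_strip (Para x) \<tau>))"
  have ar: "0 \<le> \<tau> \<and> 0 \<le> x - h - \<tau> \<and> \<tau> \<le> x \<and> x - h - \<tau> \<le> x" if "0 \<le> \<tau>" "\<tau> \<le> x - a" for \<tau>
    using that x a_pos b_nonneg b_le_a by (intro conjI) argo+
  have I: "(\<lambda>\<tau>. A (Para \<tau>)) integrable_on {0..x - a}" "(\<lambda>\<tau>. A (Trap (x - h - \<tau>))) integrable_on {0..x - a}"
    "(\<lambda>\<tau>. 2 * e (Para \<tau>) * e (Trap (x - h - \<tau>))) integrable_on {0..x - a}"
    by (intro regular_pair_integrable[where S = Para and T = Trap, OF A e _ _ _ _ ar]; simp)+
  have g1: "G \<tau> = g \<tau>" if "\<tau> < x - a" for \<tau>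
    using that unfolding G_def g_def remaining_place_Para by (simp add: algebra_simps)
  have g2: "G \<tau> = g (2 * x - 2 * a - \<tau>)" if "x - a \<le> \<tau>" for \<tau>
  proof -
    have "x - h - (2 * x - 2 * a - \<tau>) = \<tau> + d - (x - a)" by (simp add: field_simps)
    then have "g (2 * x - 2 * a - \<tau>) = A (Para (2 * x - 2 * a - \<tau>)) + A (Trap (\<tau> + d - (x - a)))
        + 2 * e (Para (2 * x - 2 * a - \<tau>)) * e (Trap (\<tau> + d - (x - a)))"
      unfolding g_def by metis
    moreover have "G \<tau> = A (Trap (\<tau> + d - (x - a))) + A (Para (2 * x - 2 * a - \<tau>))
        + 2 * e (Trap (\<tau> + d - (x - a))) * e (Para (2 * x - 2 * a - \<tau>))"
      using that unfolding G_def remaining_place_Para by simp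
    ultimately show ?thesis by simp
  qed
  have gi: "g integrable_on {0..x - a}"
    unfolding g_def by (intro integrable_add I)
  have first: "integral {0..x - a} G = integral {0..x - a} g"
    by (rule integral_cong_except_right) (use g1 in auto)
  have second: "integral {x - a..2 * x - 2 * a} G = integral {0..x - a} g"
    using integral_flip_real[of "x - a" "2 * x - 2 * a" g "2 * x - 2 * a"] g2
    by (subst Henstock_Kurzweil_Integration.integral_cong[of _ G "\<lambda>\<tau>. g (2 * x - 2 * a - \<tau>)"])
       (auto simp: algebra_simps)
  have "placement_length (Para x) * A (Para x) = integral {0..2 * x - 2 * a} G"
    using sp x unfolding splits_def G_def by (auto dest: spec[of _ "Para x"])
  also have "\<dots> = integral {0..x - a} G + integral {x - a..2 * x - 2 * a} G"
  proof (rule Henstock_Kurzweil_Integration.integral_combine[symmetric])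
    have i1: "G integrable_on {0..x - a}"
      by (rule integrable_spike[OF gi, of "{x - a}"]) (use g1 in auto)
    have ar': "0 \<le> 2 * x - 2 * a - \<tau> \<and> 0 \<le> x - h - (2 * x - 2 * a - \<tau>) \<and> 2 * x - 2 * a - \<tau> \<le> x
        \<and> x - h - (2 * x - 2 * a - \<tau>) \<le> x" if "x - a \<le> \<tau>" "\<tau> \<le> 2 * x - 2 * a" for \<tau>
      by (rule ar) (use that in argo)+
    have "(\<lambda>\<tau>. g (2 * x - 2 * a - \<tau>)) integrable_on {x - a..2 * x - 2 * a}"
      unfolding g_def
      by (intro integrable_add regular_pair_integrable[where S = Para and T = Trap, OF A e _ _ _ _ ar']; simp)
    then have i2: "G integrable_on {x - a..2 * x - 2 * a}"
      by (rule integrable_eq) (use g2 in auto)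
    show "G integrable_on {0..2 * x - 2 * a}"
      by (rule Henstock_Kurzweil_Integration.integrable_combine[OF _ _ i1 i2]) (use x in auto)
  qed (use x in auto)
  also have "\<dots> = 2 * integral {0..x - a} g"
    unfolding first second by simp
  finally have "(x - a) * A (Para x) = integral {0..x - a} g"
    by (simp add: algebra_simps)
  also have "\<dots> = integral {0..x - a} (\<lambda>\<tau>. A (Para \<tau>)) + integral {0..x - a} (\<lambda>\<tau>. A (Trap (x - h - \<tau>)))
     + integral {0..x - a} (\<lambda>\<tau>. 2 * e (Para \<tau>) * e (Trap (x - h - \<tau>)))"
    unfolding g_def by (simp add: integral_add integrable_add I)
  also have "integral {0..x - a} (\<lambda>\<tau>. A (Trap (x - h - \<tau>))) = integral {a - h..x - h} (\<lambda>x. A (Trap x))"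
    using integral_flip_real[of 0 "x - a" "\<lambda>x. A (Trap x)" "x - h"] by simp
  finally show ?thesis .
qed

text \<open>
  The condition \<open>2 * a - h \<le> x\<close> says that both placements are possible, as \<open>2 * a - h = (3 * a - b) / 2\<close>.
\<close>

lemma Trap_equation:
  assumes A: "regular A" and e: "regular e" and sp: "splits A e" and x: "h < x" "2 * a - h \<le> x"
  shows "(x - a) * A (Trap x) = integral {a - h..x - a} (\<lambda>x. A (Trap x)) + integral {0..x - h} (\<lambda>x. A (Para x))
    + (integral {0..x - a - d} (\<lambda>\<tau>. e (Trap (\<tau> + d)) * e (Trap (x - a - \<tau>)))
    + integral {0..x - h} (\<lambda>\<tau>. e (Para \<tau>) * e (Para (x - h - \<tau>))))"
proof -
  have d: "a - h = d" "d = a - h" by (simp_all add: field_simps)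
  have d0: "0 \<le> d" using b_le_a by simp
  define g1 where "g1 = (\<lambda>\<tau>. A (Trap (\<tau> + d)) + A (Trap (x - a - \<tau>))
      + 2 * e (Trap (\<tau> + d)) * e (Trap (x - a - \<tau>)))"
  define g2 where "g2 = (\<lambda>\<tau>. A (Para \<tau>) + A (Para (x - h - \<tau>)) + 2 * e (Para \<tau>) * e (Para (x - h - \<tau>)))"
  define G where "G = (\<lambda>\<tau>. A (left_strip (Trap x) \<tau>) + A (right_strip (Trap x) \<tau>)
     + 2 * e (left_strip (Trap x) \<tau>) * e (right_strip (Trap x) \<tau>))"
  have xd: "\<not> x < a + d" "0 \<le> x - a - d" "a \<le> x" "x - a - d \<le> 2 * x - 2 * a"
    using x b_le_a a_pos b_nonneg by argo+
  have ar1: "0 \<le> \<tau> + d \<and> 0 \<le> x - a - \<tau> \<and> \<tau> + d \<le> x \<and> x - a - \<tau> \<le> x" if "0 \<le> \<tau>" "\<tau> \<le> x - a - d" for \<tau>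
    using that x a_pos b_nonneg b_le_a by (intro conjI) argo+
  have ar2: "0 \<le> \<tau> \<and> 0 \<le> x - h - \<tau> \<and> \<tau> \<le> x \<and> x - h - \<tau> \<le> x" if "0 \<le> \<tau>" "\<tau> \<le> x - h" for \<tau>
    using that x a_pos b_nonneg b_le_a by (intro conjI) argo+
  have I1: "(\<lambda>\<tau>. A (Trap (\<tau> + d))) integrable_on {0..x - a - d}"
      "(\<lambda>\<tau>. A (Trap (x - a - \<tau>))) integrable_on {0..x - a - d}"
    "(\<lambda>\<tau>. 2 * e (Trap (\<tau> + d)) * e (Trap (x - a - \<tau>))) integrable_on {0..x - a - d}"
    by (intro regular_pair_integrable[where S = Trap and T = Trap, OF A e _ _ _ _ ar1]; simp)+
  have I2: "(\<lambda>\<tau>. A (Para \<tau>)) integrable_on {0..x - h}" "(\<lambda>\<tau>. A (Para (x - h - \<tau>))) integrable_on {0..x - h}"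
    "(\<lambda>\<tau>. 2 * e (Para \<tau>) * e (Para (x - h - \<tau>))) integrable_on {0..x - h}"
    by (intro regular_pair_integrable[where S = Para and T = Para, OF A e _ _ _ _ ar2]; simp)+
  have G1: "G \<tau> = g1 \<tau>" if "\<tau> < x - a - d" for \<tau>
    using that xd(1) unfolding G_def g1_def remaining_place_Trap by simp
  have G2: "G \<tau> = g2 (\<tau> - (x - a - d))" if "x - a - d \<le> \<tau>" for \<tau>
  proof -
    have "x - h - (\<tau> - (x - a - d)) = 2 * x - 2 * a - \<tau>" by (simp add: field_simps)
    then have "g2 (\<tau> - (x - a - d)) = A (Para (\<tau> - (x - a - d))) + A (Para (2 * x - 2 * a - \<tau>))
        + 2 * e (Para (\<tau> - (x - a - d))) * e (Para (2 * x - 2 * a - \<tau>))"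
      unfolding g2_def by metis
    moreover have "G \<tau> = A (Para (\<tau> - (x - a - d))) + A (Para (2 * x - 2 * a - \<tau>))
        + 2 * e (Para (\<tau> - (x - a - d))) * e (Para (2 * x - 2 * a - \<tau>))"
      using that xd(1) unfolding G_def remaining_place_Trap by simp
    ultimately show ?thesis by simp
  qed
  have g1i: "g1 integrable_on {0..x - a - d}"
    unfolding g1_def by (intro integrable_add I1)
  have first: "integral {0..x - a - d} G = integral {0..x - a - d} g1"
    by (rule integral_cong_except_right) (use G1 in auto)
  have second: "integral {x - a - d..2 * x - 2 * a} G = integral {0..x - h} g2"
  proof -
    have "G \<tau> = g2 (\<tau> + - (x - a - d))" if "x - a - d \<le> \<tau>" for \<tau>
      using G2[OF that] by (simp only: diff_conv_add_uminus[of \<tau>])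
    then have "integral {x - a - d..2 * x - 2 * a} G =
        integral {x - a - d..2 * x - 2 * a} (\<lambda>\<tau>. g2 (\<tau> + - (x - a - d)))"
      by (intro Henstock_Kurzweil_Integration.integral_cong) (simp only: atLeastAtMost_iff)
    also have "\<dots> = integral {0..2 * x - 2 * a - (x - a - d)} g2"
      unfolding integral_shift_real by simp
    also have "2 * x - 2 * a - (x - a - d) = x - h"
      by (simp add: field_simps)
    finally show ?thesis .
  qed
  have "critical_area (Trap x) < area (Trap x)"
    using x by simp
  then have "placement_length (Trap x) * A (Trap x) = integral {0..placement_length (Trap x)} G"
    using sp unfolding splits_def G_def by blast
  moreover have "placement_length (Trap x) = 2 * x - 2 * a"
    using xd(1) by (simp add: field_simps)
  ultimately have "(2 * x - 2 * a) * A (Trap x) = integral {0..2 * x - 2 * a} G"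
    by metis
  also have "\<dots> = integral {0..x - a - d} G + integral {x - a - d..2 * x - 2 * a} G"
  proof (rule Henstock_Kurzweil_Integration.integral_combine[symmetric])
    have i1: "G integrable_on {0..x - a - d}"
      by (rule integrable_spike[OF g1i, of "{x - a - d}"]) (use G1 in auto)
    have ar2': "0 \<le> \<tau> - (x - a - d) \<and> 0 \<le> x - h - (\<tau> - (x - a - d)) \<and> \<tau> - (x - a - d) \<le> x
        \<and> x - h - (\<tau> - (x - a - d)) \<le> x" if "x - a - d \<le> \<tau>" "\<tau> \<le> 2 * x - 2 * a" for \<tau>
      by (rule ar2) (use that in argo)+
    have "(\<lambda>\<tau>. g2 (\<tau> - (x - a - d))) integrable_on {x - a - d..2 * x - 2 * a}"
      unfolding g2_def
      by (intro integrable_add regular_pair_integrable[where S = Para and T = Para, OF A e _ _ _ _ ar2']; simp)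
    then have i2: "G integrable_on {x - a - d..2 * x - 2 * a}"
      by (rule integrable_eq) (use G2 in auto)
    show "G integrable_on {0..2 * x - 2 * a}"
      by (rule Henstock_Kurzweil_Integration.integrable_combine[OF xd(2,4) i1 i2])
  qed (use xd in auto)
  finally have E: "(2 * x - 2 * a) * A (Trap x) = integral {0..x - a - d} g1 + integral {0..x - h} g2"
    unfolding first second .
  have "integral {0..x - a - d} g1 = integral {0..x - a - d} (\<lambda>\<tau>. A (Trap (\<tau> + d)))
      + integral {0..x - a - d} (\<lambda>\<tau>. A (Trap (x - a - \<tau>)))
     + integral {0..x - a - d} (\<lambda>\<tau>. 2 * e (Trap (\<tau> + d)) * e (Trap (x - a - \<tau>)))"
    unfolding g1_def by (simp add: integral_add integrable_add I1)
  also have "integral {0..x - a - d} (\<lambda>\<tau>. A (Trap (\<tau> + d))) = integral {d..x - a} (\<lambda>x. A (Trap x))"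
    using integral_shift_real[of 0 "x - a - d" "\<lambda>x. A (Trap x)" d] by simp
  also have "integral {0..x - a - d} (\<lambda>\<tau>. A (Trap (x - a - \<tau>))) = integral {d..x - a} (\<lambda>x. A (Trap x))"
    using integral_flip_real[of 0 "x - a - d" "\<lambda>x. A (Trap x)" "x - a"] by simp
  also have "integral {0..x - a - d} (\<lambda>\<tau>. 2 * e (Trap (\<tau> + d)) * e (Trap (x - a - \<tau>)))
     = 2 * integral {0..x - a - d} (\<lambda>\<tau>. e (Trap (\<tau> + d)) * e (Trap (x - a - \<tau>)))"
    by (simp only: mult.assoc integral_mult_right)
  finally have E1: "integral {0..x - a - d} g1 = integral {d..x - a} (\<lambda>x. A (Trap x))
      + integral {d..x - a} (\<lambda>x. A (Trap x))
    + 2 * integral {0..x - a - d} (\<lambda>\<tau>. e (Trap (\<tau> + d)) * e (Trap (x - a - \<tau>)))" .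
  have "integral {0..x - h} g2 = integral {0..x - h} (\<lambda>\<tau>. A (Para \<tau>))
      + integral {0..x - h} (\<lambda>\<tau>. A (Para (x - h - \<tau>)))
     + integral {0..x - h} (\<lambda>\<tau>. 2 * e (Para \<tau>) * e (Para (x - h - \<tau>)))"
    unfolding g2_def by (simp add: integral_add integrable_add I2)
  also have "integral {0..x - h} (\<lambda>\<tau>. A (Para (x - h - \<tau>))) = integral {0..x - h} (\<lambda>x. A (Para x))"
    using integral_flip_real[of 0 "x - h" "\<lambda>x. A (Para x)" "x - h"] by simp
  also have "integral {0..x - h} (\<lambda>\<tau>. 2 * e (Para \<tau>) * e (Para (x - h - \<tau>)))
     = 2 * integral {0..x - h} (\<lambda>\<tau>. e (Para \<tau>) * e (Para (x - h - \<tau>)))"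
    by (simp only: mult.assoc integral_mult_right)
  finally have E2: "integral {0..x - h} g2 = integral {0..x - h} (\<lambda>x. A (Para x))
      + integral {0..x - h} (\<lambda>x. A (Para x))
    + 2 * integral {0..x - h} (\<lambda>\<tau>. e (Para \<tau>) * e (Para (x - h - \<tau>)))" .
  have "2 * ((x - a) * A (Trap x)) = (2 * x - 2 * a) * A (Trap x)"
    by (simp add: algebra_simps)
  then show ?thesis
    using E unfolding E1 E2 d(1) by linarith
qed

section \<open>First and second moments\<close>

text \<open>
  The mean of \<open>N + 1\<close>, where \<open>N\<close> is the number of particles. Adding \<open>1\<close> makes it additive.
\<close>

definition mean :: "strip \<Rightarrow> real" where
  "mean s = (\<integral>k. real k + 1 \<partial>num_particles s)"

text \<open>
  The mean of \<open>N + 1 - c * (area + h)\<close>, and the mean of its square.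
\<close>

definition deviation :: "real \<Rightarrow> strip \<Rightarrow> real" where
  "deviation c s = mean s - c * (area s + h)"

definition square_deviation :: "real \<Rightarrow> strip \<Rightarrow> real" where
  "square_deviation c s = (\<integral>k. (real k + 1 - c * (area s + h))\<^sup>2 \<partial>num_particles s)"

lemma measure_num_particles [simp]: "measure (num_particles s) UNIV = 1"
  using prob_space.prob_space[OF prob_space_num_particles[of s]] by simp

lemma abs_integral_num_particles_le:
  fixes f :: "nat \<Rightarrow> real"
  assumes "\<And>k. real k \<le> max 0 (area s) / h \<Longrightarrow> \<bar>f k\<bar> \<le> B"
  shows "\<bar>\<integral>k. f k \<partial>num_particles s\<bar> \<le> B"
proof -
  have h: "0 < h" using a_pos b_nonneg by simp
  have "AE k in num_particles s. \<bar>f k\<bar> \<le> B"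
    using num_particles_le[of s]
    by eventually_elim (use h in \<open>auto intro!: assms simp: pos_le_divide_eq\<close>)
  from integral_mono_AE[OF integrable_num_particles integrable_num_particles this]
  have "(\<integral>k. \<bar>f k\<bar> \<partial>num_particles s) \<le> B"
    by simp
  then show ?thesis
    by (rule order_trans[OF integral_abs_bound])
qed

lemma measurable_expectation:
  assumes f: "\<And>k. 0 \<le> (f k :: real)"
  shows "(\<lambda>x. \<integral>k. f k \<partial>num_particles (Para x)) \<in> borel_measurable borel"
    "(\<lambda>x. \<integral>k. f k \<partial>num_particles (Trap x)) \<in> borel_measurable borel"
proof -
  have eq: "(\<integral>k. f k \<partial>num_particles s) = enn2real (\<integral>\<^sup>+k. f k \<partial>num_particles s)" for s
    by (rule integral_eq_nn_integral) (auto simp: f)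
  have "(\<lambda>M. \<integral>\<^sup>+k. f k \<partial>M) \<in> borel_measurable (subprob_algebra nat_measure)"
    by (rule nn_integral_measurable_subprob_algebra) simp
  then have "(\<lambda>x. enn2real (\<integral>\<^sup>+k. f k \<partial>num_particles (Para x))) \<in> borel_measurable borel"
    "(\<lambda>x. enn2real (\<integral>\<^sup>+k. f k \<partial>num_particles (Trap x))) \<in> borel_measurable borel"
    using measurable_num_particles[THEN measurable_prob_algebraD]
    by (auto intro!: measurable_compose[OF _ borel_measurable_enn2real[OF measurable_ident_sets]]
        measurable_compose[of _ borel "subprob_algebra nat_measure"])
  then show "(\<lambda>x. \<integral>k. f k \<partial>num_particles (Para x)) \<in> borel_measurable borel"
    "(\<lambda>x. \<integral>k. f k \<partial>num_particles (Trap x)) \<in> borel_measurable borel"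
    by (simp_all add: eq)
qed

lemma regular_mean: "regular mean"
  unfolding regular_def
proof (intro conjI allI)
  show "(\<lambda>x. mean (Para x)) \<in> borel_measurable borel" "(\<lambda>x. mean (Trap x)) \<in> borel_measurable borel"
    unfolding mean_def by (intro measurable_expectation; simp)+
  fix X
  have h: "0 < h" using a_pos b_nonneg by simp
  have "\<bar>mean s\<bar> \<le> X / h + 1" if s: "0 \<le> area s" "area s \<le> X" for s
    unfolding mean_def
  proof (rule abs_integral_num_particles_le)
    fix k assume "real k \<le> max 0 (area s) / h"
    also have "\<dots> \<le> X / h" using s h by (intro divide_right_mono) auto
    finally show "\<bar>real k + 1\<bar> \<le> X / h + 1" by linarith
  qed
  then show "\<exists>K. \<forall>s. 0 \<le> area s \<and> area s \<le> X \<longrightarrow> \<bar>mean s\<bar> \<le> K"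
    by blast
qed

lemma regular_deviation: "regular (deviation c)"
  unfolding regular_def
proof (intro conjI allI)
  show "(\<lambda>x. deviation c (Para x)) \<in> borel_measurable borel"
    "(\<lambda>x. deviation c (Trap x)) \<in> borel_measurable borel"
    using regular_measurable(1,2)[OF regular_mean] unfolding deviation_def by (simp, measurable)+
  fix X
  have h: "0 < h" using a_pos b_nonneg by simp
  obtain K where K: "\<And>s. 0 \<le> area s \<Longrightarrow> area s \<le> X \<Longrightarrow> \<bar>mean s\<bar> \<le> K"
    using regular_bounded[OF regular_mean, of X] by blast
  have "\<bar>deviation c s\<bar> \<le> K + \<bar>c\<bar> * (X + h)" if "0 \<le> area s" "area s \<le> X" for s
  proof -
    have "\<bar>c * (area s + h)\<bar> \<le> \<bar>c\<bar> * (X + h)"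
      unfolding abs_mult using that h by (intro mult_left_mono) auto
    then show ?thesis
      using K[OF that] unfolding deviation_def by linarith
  qed
  then show "\<exists>K. \<forall>s. 0 \<le> area s \<and> area s \<le> X \<longrightarrow> \<bar>deviation c s\<bar> \<le> K"
    by blast
qed

lemma square_deviation_eq:
  "square_deviation c s = (\<integral>k. (real k + 1)\<^sup>2 \<partial>num_particles s) - 2 * (c * (area s + h)) * mean s
      + (c * (area s + h))\<^sup>2"
proof -
  have "(\<integral>k. (real k + 1 - t)\<^sup>2 \<partial>num_particles s) =
      (\<integral>k. (real k + 1)\<^sup>2 - 2 * t * (real k + 1) + t\<^sup>2 \<partial>num_particles s)" for t
    by (rule Bochner_Integration.integral_cong) (simp_all add: power2_eq_square algebra_simps)
  also have "\<dots> t = (\<integral>k. (real k + 1)\<^sup>2 \<partial>num_particles s) - 2 * t * (\<integral>k. real k + 1 \<partial>num_particles s)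
      + t\<^sup>2" for t
    by (simp only: Bochner_Integration.integral_add Bochner_Integration.integral_diff integrable_num_particles
        integral_mult_right_zero) simp
  finally show ?thesis
    by (simp only: square_deviation_def mean_def)
qed

lemma regular_square_deviation: "regular (square_deviation c)"
  unfolding regular_def
proof (intro conjI allI)
  note [measurable] = regular_measurable(1,2)[OF regular_mean]
    measurable_expectation[of "\<lambda>k. (real k + 1)\<^sup>2", OF zero_le_power2]
  show "(\<lambda>x. square_deviation c (Para x)) \<in> borel_measurable borel"
    "(\<lambda>x. square_deviation c (Trap x)) \<in> borel_measurable borel"
    unfolding square_deviation_eq by (simp, measurable)+
  fix X
  have h: "0 < h" using a_pos b_nonneg by simp
  have "\<bar>square_deviation c s\<bar> \<le> (X / h + 1 + \<bar>c\<bar> * (X + h))\<^sup>2" if s: "0 \<le> area s" "area s \<le> X" for s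
    unfolding square_deviation_def
  proof (rule abs_integral_num_particles_le)
    fix k assume "real k \<le> max 0 (area s) / h"
    also have "\<dots> \<le> X / h" using s h by (intro divide_right_mono) auto
    finally have k: "real k \<le> X / h" .
    have "\<bar>c * (area s + h)\<bar> \<le> \<bar>c\<bar> * (X + h)"
      unfolding abs_mult using s h by (intro mult_left_mono) auto
    then have "\<bar>real k + 1 - c * (area s + h)\<bar> \<le> X / h + 1 + \<bar>c\<bar> * (X + h)"
      using k by linarith
    then have "\<bar>real k + 1 - c * (area s + h)\<bar>\<^sup>2 \<le> (X / h + 1 + \<bar>c\<bar> * (X + h))\<^sup>2"
      by (rule power_mono) simp
    then show "\<bar>(real k + 1 - c * (area s + h))\<^sup>2\<bar> \<le> (X / h + 1 + \<bar>c\<bar> * (X + h))\<^sup>2"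
      by simp
  qed
  then show "\<exists>K. \<forall>s. 0 \<le> area s \<and> area s \<le> X \<longrightarrow> \<bar>square_deviation c s\<bar> \<le> K"
    by blast
qed

lemma splits_of_convolution:
  assumes s: "critical_area s < area s" and A: "regular A" and e: "regular e" and f: "\<And>k. 0 \<le> (f k :: real)"
    and conv: "\<And>l r. area l + area r = area s - h \<Longrightarrow>
      (\<integral>m. \<integral>n. f (1 + m + n) \<partial>num_particles r \<partial>num_particles l) = A l + A r + 2 * e l * e r"
  shows "placement_length s * (\<integral>k. f k \<partial>num_particles s) = integral {0..placement_length s} (\<lambda>\<tau>.
      A (left_strip s \<tau>) + A (right_strip s \<tau>) + 2 * e (left_strip s \<tau>) * e (right_strip s \<tau>))"
proof -
  obtain K where K: "0 \<le> K" "\<And>t. 0 \<le> area t \<Longrightarrow> area t \<le> area s - h \<Longrightarrow> \<bar>A t\<bar> \<le> K"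
    using regular_bounded[OF A, of "area s - h"] by blast
  obtain L where L: "0 \<le> L" "\<And>t. 0 \<le> area t \<Longrightarrow> area t \<le> area s - h \<Longrightarrow> \<bar>e t\<bar> \<le> L"
    using regular_bounded[OF e, of "area s - h"] by blast
  show ?thesis
  proof (rule integral_num_particles[OF s f, where K = "2 * K + 2 * (L * L)"])
    fix \<tau> assume \<tau>: "0 < \<tau>" "\<tau> < placement_length s"
    let ?l = "left_strip s \<tau>" and ?r = "right_strip s \<tau>"
    note B = remaining_area_sum[OF \<tau>]
    show "A ?l + A ?r + 2 * e ?l * e ?r = (\<integral>m. \<integral>n. f (1 + m + n) \<partial>num_particles ?r \<partial>num_particles ?l)"
      by (rule conv[OF B(1), symmetric])
    have "\<bar>A ?l\<bar> \<le> K" "\<bar>A ?r\<bar> \<le> K" "\<bar>e ?l\<bar> \<le> L" "\<bar>e ?r\<bar> \<le> L"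
      using B by (auto intro!: K L)
    moreover from this have "\<bar>e ?l\<bar> * \<bar>e ?r\<bar> \<le> L * L"
      using L by (intro mult_mono) auto
    then have "\<bar>2 * e ?l * e ?r\<bar> \<le> 2 * (L * L)"
      by (simp add: abs_mult)
    ultimately show "\<bar>A ?l + A ?r + 2 * e ?l * e ?r\<bar> \<le> 2 * K + 2 * (L * L)"
      by linarith
  next
    show "(\<lambda>\<tau>. A (left_strip s \<tau>) + A (right_strip s \<tau>) + 2 * e (left_strip s \<tau>) * e (right_strip s \<tau>))
        \<in> borel_measurable borel"
      by (intro borel_measurable_add borel_measurable_times borel_measurable_const regular_measurable(3,4) A e)
  qed
qed

lemma regular_zero: "regular (\<lambda>_. 0)"
  by (auto simp: regular_def)

lemma splits_mean: "splits mean (\<lambda>_. 0)"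
  unfolding splits_def
proof (intro allI impI)
  fix s assume s: "critical_area s < area s"
  have conv: "(\<integral>m. \<integral>n. real (1 + m + n) + 1 \<partial>num_particles r \<partial>num_particles l) = mean l + mean r
      + 2 * 0 * 0" for l r
    unfolding mean_def by (simp add: algebra_simps)
  show "placement_length s * mean s = integral {0..placement_length s}
      (\<lambda>\<tau>. mean (left_strip s \<tau>) + mean (right_strip s \<tau>) + 2 * 0 * 0)"
    unfolding mean_def[of s]
    by (rule splits_of_convolution[where e = "\<lambda>_. 0", OF s regular_mean regular_zero _ conv]) simp
qed

text \<open>
  Since \<open>N + 1\<close> and \<open>area + h\<close> are additive, so is \<open>N + 1 - c * (area + h)\<close>. The two summands are
  independent given the placement, and the cross term is the product of their means.
\<close>

lemma splits_square_deviation: "splits (square_deviation c) (deviation c)"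
  unfolding splits_def
proof (intro allI impI)
  fix s assume s: "critical_area s < area s"
  have conv: "(\<integral>m. \<integral>n. (real (1 + m + n) + 1 - c * (area s + h))\<^sup>2 \<partial>num_particles r \<partial>num_particles l)
      = square_deviation c l + square_deviation c r + 2 * deviation c l * deviation c r"
    if area: "area l + area r = area s - h" for l r
  proof -
    define F where "F = (\<lambda>t (k :: nat). real k + 1 - c * (area t + h))"
    have "area s + h = (area l + h) + (area r + h)"
      using area by linarith
    then have F: "real (1 + m + n) + 1 - c * (area s + h) = F l m + F r n" for m n
      by (simp add: F_def algebra_simps)
    have dev: "(\<integral>k. F t k \<partial>num_particles t) = deviation c t" for t
      by (simp add: F_def deviation_def mean_def)
    have "(\<integral>m. \<integral>n. (real (1 + m + n) + 1 - c * (area s + h))\<^sup>2 \<partial>num_particles r \<partial>num_particles l)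
      = (\<integral>m. \<integral>n. (F l m)\<^sup>2 + 2 * F l m * F r n + (F r n)\<^sup>2 \<partial>num_particles r \<partial>num_particles l)"
      unfolding F by (simp add: power2_sum add_ac)
    also have "\<dots> = (\<integral>m. (F l m)\<^sup>2 + 2 * F l m * deviation c r + square_deviation c r \<partial>num_particles l)"
      by (simp add: integral_add dev) (simp add: F_def square_deviation_def)
    also have "\<dots> = square_deviation c l + 2 * deviation c l * deviation c r + square_deviation c r"
      by (simp add: integral_add dev) (simp add: F_def square_deviation_def)
    finally show ?thesis by simp
  qed
  show "placement_length s * square_deviation c s = integral {0..placement_length s}
      (\<lambda>\<tau>. square_deviation c (left_strip s \<tau>) + square_deviation c (right_strip s \<tau>)
        + 2 * deviation c (left_strip s \<tau>) * deviation c (right_strip s \<tau>))"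
    unfolding square_deviation_def[of c s]
    by (rule splits_of_convolution[OF s regular_square_deviation regular_deviation _ conv]) simp_all
qed

lemma variance_num_particles:
  "prob_space.variance (num_particles s) real = square_deviation c s - (deviation c s)\<^sup>2"
proof -
  interpret prob_space "num_particles s" by (rule prob_space_num_particles)
  define Y where "Y = (\<lambda>k :: nat. real k + 1 - c * (area s + h))"
  have "variance real = variance Y"
    by (simp add: Y_def)
  also have "\<dots> = expectation (\<lambda>k. (Y k)\<^sup>2) - (expectation Y)\<^sup>2"
    by (rule variance_eq) auto
  also have "expectation Y = deviation c s"
    by (simp add: Y_def deviation_def mean_def)
  finally show ?thesis
    by (simp add: Y_def square_deviation_def)
qed

section \<open>Asymptotics of the variance\<close>

interpretation delay a h
  by unfold_locales (use a_pos b_nonneg b_le_a in \<open>auto simp: field_simps\<close>)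

text \<open>
  The functional \<open>A\<close> on parallelograms and on trapeziums solves the coupled system, with forcing terms that
  are convolutions of \<open>e\<close>.
\<close>

lemma splits_asymptotics:
  assumes A: "regular A" and e: "regular e" and sp: "splits A e" and \<eta>: "0 < \<eta>"
    and se: "superexp \<eta> (\<lambda>x. e (Para x))" "superexp \<eta> (\<lambda>x. e (Trap x))"
  shows "\<exists>c. superexp (5 * \<eta>) (\<lambda>x. A (Para x) - c * (x + h)) \<and> superexp (5 * \<eta>) (\<lambda>x. A (Trap x) - c * (x + h))"
proof -
  have d: "a - h = d" "0 \<le> d" "d + h = a" using b_le_a by (simp_all add: field_simps)
  have "superexp (5 * \<eta>) (\<lambda>x. integral {0..x - a} (\<lambda>\<tau>. e (Para \<tau>) * e (Trap (x - h - \<tau>))))"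
  proof (rule superexp_convolution[OF se \<eta>])
    fix x \<tau> :: real assume \<tau>: "0 \<le> \<tau>" "\<tau> \<le> x - a"
    show "\<exists>p p'. 0 \<le> p \<and> 0 \<le> p' \<and> p + p' = x - h \<and> \<bar>e (Para \<tau>) * e (Trap (x - h - \<tau>))\<bar>
        \<le> \<bar>e (Para p)\<bar> * \<bar>e (Trap p')\<bar>"
      by (rule exI[of _ \<tau>], rule exI[of _ "x - h - \<tau>"], intro conjI)
         (use \<tau> d h_le_a in \<open>linarith | simp add: abs_mult\<close>)+
  qed (use a_pos in simp)
  from superexp_cmult[OF this, of 2]
  have r1: "superexp (5 * \<eta>) (\<lambda>x. integral {0..x - a} (\<lambda>\<tau>. 2 * e (Para \<tau>) * e (Trap (x - h - \<tau>))))"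
    by (simp only: mult.assoc integral_mult_right)
  have "superexp (5 * \<eta>) (\<lambda>x. integral {0..x - a - d} (\<lambda>\<tau>. e (Trap (\<tau> + d)) * e (Trap (x - a - \<tau>))))"
  proof (rule superexp_convolution[OF se(2) se(2) \<eta>])
    fix x \<tau> :: real assume \<tau>: "0 \<le> \<tau>" "\<tau> \<le> x - a - d"
    show "\<exists>p p'. 0 \<le> p \<and> 0 \<le> p' \<and> p + p' = x - h \<and> \<bar>e (Trap (\<tau> + d)) * e (Trap (x - a - \<tau>))\<bar>
        \<le> \<bar>e (Trap p)\<bar> * \<bar>e (Trap p')\<bar>"
      by (rule exI[of _ "\<tau> + d"], rule exI[of _ "x - a - \<tau>"], intro conjI)
         (use \<tau> d h_le_a in \<open>linarith | simp add: abs_mult\<close>)+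
  qed (use a_pos d in linarith)
  moreover have "superexp (5 * \<eta>) (\<lambda>x. integral {0..x - h} (\<lambda>\<tau>. e (Para \<tau>) * e (Para (x - h - \<tau>))))"
  proof (rule superexp_convolution[OF se(1) se(1) \<eta>])
    fix x \<tau> :: real assume \<tau>: "0 \<le> \<tau>" "\<tau> \<le> x - h"
    show "\<exists>p p'. 0 \<le> p \<and> 0 \<le> p' \<and> p + p' = x - h \<and> \<bar>e (Para \<tau>) * e (Para (x - h - \<tau>))\<bar>
        \<le> \<bar>e (Para p)\<bar> * \<bar>e (Para p')\<bar>"
      by (rule exI[of _ \<tau>], rule exI[of _ "x - h - \<tau>"], intro conjI)
         (use \<tau> d h_le_a in \<open>linarith | simp add: abs_mult\<close>)+
  qed (use a_pos b_nonneg in simp)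
  ultimately have r2: "superexp (5 * \<eta>) (\<lambda>x.
    integral {0..x - a - d} (\<lambda>\<tau>. e (Trap (\<tau> + d)) * e (Trap (x - a - \<tau>)))
    + integral {0..x - h} (\<lambda>\<tau>. e (Para \<tau>) * e (Para (x - h - \<tau>))))"
    by (rule superexp_add)
  show ?thesis
  proof (rule coupled_asymptotics[OF regular_bdd[OF A] regular_integrable[OF A] r1 r2, where ?X0.0 = "2 * a"])
    fix x assume x: "2 * a \<le> x"
    have x': "a < x" "h < x" "2 * a - h \<le> x" using x a_pos h_le_a h_pos by linarith+
    show "(x - a) * A (Para x) = integral {0..x - a} (\<lambda>x. A (Para x)) + integral {a - h..x - h} (\<lambda>x. A (Trap x))
      + integral {0..x - a} (\<lambda>\<tau>. 2 * e (Para \<tau>) * e (Trap (x - h - \<tau>)))"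
      by (rule Para_equation[OF A e sp x'(1)])
    show "(x - a) * A (Trap x) = integral {a - h..x - a} (\<lambda>x. A (Trap x)) + integral {0..x - h} (\<lambda>x. A (Para x))
        + (integral {0..x - a - d} (\<lambda>\<tau>. e (Trap (\<tau> + d)) * e (Trap (x - a - \<tau>)))
        + integral {0..x - h} (\<lambda>\<tau>. e (Para \<tau>) * e (Para (x - h - \<tau>))))"
      by (rule Trap_equation[OF A e sp x'(2,3)])
  qed (use \<eta> h_pos in auto)
qed

lemma superexp_tendsto:
  assumes "superexp \<eta> E"
  shows "(E \<longlongrightarrow> 0) at_top"
proof (rule Lim_null_comparison)
  have "((\<lambda>x. \<bar>(x + h) * E x\<bar> / h) \<longlongrightarrow> \<bar>0\<bar> / h) at_top"
    using h_pos by (intro tendsto_intros rapid_tendsto superexp_imp_rapid[OF assms]) auto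
  then show "((\<lambda>x. \<bar>(x + h) * E x\<bar> / h) \<longlongrightarrow> 0) at_top" by simp
  show "\<forall>\<^sub>F x in at_top. norm (E x) \<le> \<bar>(x + h) * E x\<bar> / h"
    using eventually_ge_at_top[of 0]
  proof eventually_elim
    case (elim x)
    have "h \<le> \<bar>x + h\<bar>" using elim by linarith
    then have "h * \<bar>E x\<bar> \<le> \<bar>x + h\<bar> * \<bar>E x\<bar>"
      by (rule mult_right_mono) simp
    then show ?case
      unfolding pos_le_divide_eq[OF h_pos] abs_mult by (simp add: mult.commute)
  qed
qed

lemma mean_ge_1: "1 \<le> mean s"
proof -
  have "mean s = (\<integral>k. real k \<partial>num_particles s) + 1"
    by (simp add: mean_def)
  moreover have "0 \<le> (\<integral>k. real k \<partial>num_particles s)"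
    by simp
  ultimately show ?thesis by linarith
qed

lemma mean_growth_pos:
  assumes "superexp \<eta> (\<lambda>x. deviation c (Para x))"
  shows "0 < c"
proof (rule ccontr)
  assume c: "\<not> 0 < c"
  have "1 \<le> deviation c (Para x)" if "0 \<le> x" for x
    using mean_ge_1[of "Para x"] mult_nonpos_nonneg[of c "x + h"] that c h_pos by (simp add: deviation_def)
  then have "1 \<le> (0 :: real)"
    by (intro tendsto_lowerbound[OF superexp_tendsto[OF assms]]
        eventually_mono[OF eventually_ge_at_top[of 0]]) auto
  then show False by simp
qed

text \<open>
  At the points \<open>x\<close> for which \<open>c * (x + h)\<close> is a half-integer, the integer \<open>N + 1\<close> has distance at least
  \<open>1 / 2\<close> from it, so that the mean square deviation is at least \<open>1 / 4\<close>.
\<close>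

lemma variance_growth_pos:
  assumes c: "0 < c" and se: "superexp \<eta> (\<lambda>x. square_deviation c (Para x) - v * (x + h))"
  shows "0 < v"
proof (rule ccontr)
  assume v: "\<not> 0 < v"
  have "\<forall>\<^sub>F x in at_top. \<bar>square_deviation c (Para x) - v * (x + h)\<bar> < 1 / 4"
    using tendstoD[OF superexp_tendsto[OF se], of "1 / 4"] by simp
  then obtain X where X: "\<And>x. X \<le> x \<Longrightarrow> \<bar>square_deviation c (Para x) - v * (x + h)\<bar> < 1 / 4"
    unfolding eventually_at_top_linorder by blast
  define N where "N = nat \<lceil>c * (max 0 X + h)\<rceil>"
  define x where "x = (real N + 1 / 2) / c - h"
  have cx: "c * (x + h) = real N + 1 / 2" using c by (simp add: x_def)
  have "c * (max 0 X + h) \<le> c * (x + h)"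
    unfolding cx N_def by linarith
  then have x: "0 \<le> x" "X \<le> x" using c by auto
  have sq: "1 / 4 \<le> (real k + 1 - c * (area (Para x) + h))\<^sup>2" for k :: nat
  proof -
    have "1 / 2 \<le> \<bar>real k + 1 - (real N + 1 / 2)\<bar>"
    proof (cases "k < N")
      case True
      then have "real k + 1 \<le> real N" by linarith
      then show ?thesis by linarith
    next
      case False
      then have "real N \<le> real k" by linarith
      then show ?thesis by linarith
    qed
    then have "(1 / 2)\<^sup>2 \<le> \<bar>real k + 1 - (real N + 1 / 2)\<bar>\<^sup>2"
      by (rule power_mono) simp
    then show ?thesis by (simp add: cx power2_eq_square)
  qed
  have "(\<integral>k. 1 / 4 \<partial>num_particles (Para x)) \<le> square_deviation c (Para x)"
    unfolding square_deviation_def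
        by (rule integral_mono[OF integrable_num_particles integrable_num_particles sq])
  moreover have "v * (x + h) \<le> 0"
    using v x h_pos by (intro mult_nonpos_nonneg) auto
  ultimately show False
    using X[OF x(2)] by simp
qed

text \<open>
  The exponents \<open>1 / 25\<close> for the vanishing cross term of the mean and \<open>1 / 5\<close> for the error of the mean
  are chosen so that, after two losses of a factor \<open>5\<close>, the estimate for the variance has exponent \<open>1\<close>.
\<close>

lemma variance_asymptotics:
  "\<exists>v>0. superexp 1 (\<lambda>x. prob_space.variance (num_particles (Para x)) real - v * (x + h)) \<and>
         superexp 1 (\<lambda>x. prob_space.variance (num_particles (Trap x)) real - v * (x + h))"
proof -
  have z: "superexp (1 / 25) (\<lambda>x. 0)"
    unfolding superexp_def by (intro exI[of _ 0]) simp
  obtain c where c: "superexp (1 / 5) (\<lambda>x. deviation c (Para x))" "superexp (1 / 5) (\<lambda>x. deviation c (Trap x))"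
    using splits_asymptotics[OF regular_mean regular_zero splits_mean _ z z] by (auto simp: deviation_def)
  obtain v where v: "superexp 1 (\<lambda>x. square_deviation c (Para x) - v * (x + h))"
      "superexp 1 (\<lambda>x. square_deviation c (Trap x) - v * (x + h))"
    using splits_asymptotics[OF regular_square_deviation regular_deviation splits_square_deviation _ c] by auto
  have square: "superexp 1 (\<lambda>x. (E x)\<^sup>2)" if E: "superexp (1 / 5) E" for E
  proof -
    obtain K where K: "\<And>x. 0 \<le> x \<Longrightarrow> \<bar>E x\<bar> \<le> K"
      using superexp_imp_rapid[OF E] unfolding rapid_def by (metis mult.right_neutral rate_zero_left)
    have "\<bar>(E x)\<^sup>2\<bar> \<le> K * \<bar>E x\<bar>" if "0 \<le> x" for x
      using mult_right_mono[OF K[OF that], of "\<bar>E x\<bar>"] by (simp add: power2_eq_square)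
    then show ?thesis
      by (intro superexp_mono[OF E, where K = K]) auto
  qed
  have var: "prob_space.variance (num_particles s) real - t
      = (square_deviation c s - t) - (deviation c s)\<^sup>2" for s t
    by (simp add: variance_num_particles[of s c])
  have "superexp 1 (\<lambda>x. prob_space.variance (num_particles (Para x)) real - v * (x + h))"
    unfolding var by (rule superexp_diff[OF v(1) square[OF c(1)]])
  moreover have "superexp 1 (\<lambda>x. prob_space.variance (num_particles (Trap x)) real - v * (x + h))"
    unfolding var by (rule superexp_diff[OF v(2) square[OF c(2)]])
  moreover have "0 < v"
    by (rule variance_growth_pos[OF mean_growth_pos[OF c(1)] v(1)])
  ultimately show ?thesis by blast
qed

text \<open>
  In both cases of the definition of \<open>R2\<close>, the number subtracted in the exponent is nonnegative, and this is
  all that matters: for \<open>x \<ge> 4 e a\<close> the base is at most \<open>1\<close>.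
\<close>

lemma superexp_R2_bound:
  assumes "superexp 1 E"
  shows "\<exists>C\<ge>0. \<forall>x\<ge>a. \<bar>E x\<bar> \<le> C * R2 a b x"
proof (cases "a = b")
  case True
  then show ?thesis
    using superexp_powr_bound[OF assms, of 4] unfolding R2_def by simp
next
  case False
  then show ?thesis
    using superexp_powr_bound[OF assms, of "5 + (a + b) / (2 * a)"] a_pos b_nonneg unfolding R2_def by simp
qed

lemma variance_bound:
  "\<exists>v>0. \<exists>C\<ge>0. \<forall>x\<ge>a. \<forall>S\<in>{Para, Trap}.
    \<bar>prob_space.variance (num_particles (S x)) real - v * (x + h)\<bar> \<le> C * R2 a b x"
proof -
  obtain v where v: "0 < v"
    "superexp 1 (\<lambda>x. prob_space.variance (num_particles (Para x)) real - v * (x + h))"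
    "superexp 1 (\<lambda>x. prob_space.variance (num_particles (Trap x)) real - v * (x + h))"
    using variance_asymptotics by blast
  obtain C where C: "0 \<le> C" "\<forall>x\<ge>a. \<bar>prob_space.variance (num_particles (Para x)) real - v * (x + h)\<bar>
      \<le> C * R2 a b x"
    using superexp_R2_bound[OF v(2)] by blast
  obtain D where D: "0 \<le> D" "\<forall>x\<ge>a. \<bar>prob_space.variance (num_particles (Trap x)) real - v * (x + h)\<bar>
      \<le> D * R2 a b x"
    using superexp_R2_bound[OF v(3)] by blast
  have "0 \<le> R2 a b x" for x
    by (simp add: R2_def)
  then have le: "C * R2 a b x \<le> max C D * R2 a b x" "D * R2 a b x \<le> max C D * R2 a b x" for x
    by (auto intro!: mult_right_mono)
  show ?thesis
    by (rule exI[of _ v], intro conjI v(1), rule exI[of _ "max C D"])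
       (use C D in \<open>auto intro: order_trans[OF _ le(1)] order_trans[OF _ le(2)] simp: le_max_iff_disj\<close>)
qed

end

theorem theorem1p8:
  fixes a b :: real
  assumes "0 \<le> b" and "b \<le> a" and "0 < a"
  shows "\<exists>lam2 C :: real. lam2 > 0 \<and> C > 0 \<and>
    (\<forall>x > (3 * a - b) / 2.
      (MAX s \<in> {Para, Trap}.
        \<bar>prob_space.variance (trapezium.num_particles a b (s x)) real - lam2 * (x + (a + b) / 2)\<bar>)
      \<le> C * R2 a b x)"
proof -
  interpret trapezium a b
    by unfold_locales (fact assms)+
  obtain v C where v: "0 < v" and C: "0 \<le> C" and bound: "\<And>x S. a \<le> x \<Longrightarrow> S \<in> {Para, Trap} \<Longrightarrow>
      \<bar>prob_space.variance (num_particles (S x)) real - v * (x + (a + b) / 2)\<bar> \<le> C * R2 a b x"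
    using variance_bound by blast
  show ?thesis
  proof (rule exI[of _ v], rule exI[of _ "C + 1"], intro conjI allI impI)
    fix x assume "(3 * a - b) / 2 < x"
    then have x: "a \<le> x" using assms by simp
    have "C * R2 a b x \<le> (C + 1) * R2 a b x"
      by (simp add: R2_def mult_right_mono)
    then show "(MAX s \<in> {Para, Trap}.
        \<bar>prob_space.variance (num_particles (s x)) real - v * (x + (a + b) / 2)\<bar>) \<le> (C + 1) * R2 a b x"
      by (intro Max_pair_le order_trans[OF bound[OF x]]) simp_all
  qed (use v C in auto)
qed

end
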